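(* Let $\theta$ be a large enough regular cardinal, $(X,\tau)\in H(\theta)$ a Lindelöf topological space, and $\mathbb{P}\in H(\theta)$ a poset. Suppose that the set of countable $M\prec H(\theta)$ such that $\mathbb{P}$ is strongly proper for $M$ is stationary in $[H(\theta)]^{\aleph_0}$. Then $\mathbb{P}$ forces that $(X,\tau)$ is Lindelöf.
   Context: $H(\theta)$ is the collection of sets hereditarily of cardinality $<\theta$; "large enough" has its usual meaning ($\theta\ge\omega_2$ and $H(\theta)$ contains all relevant objects, such as power sets, topologies, and names built from $\mathbb{P}$ and $X$). Strong properness. Let $M\prec H(\theta)$ be countable with $\mathbb{P}\in M$. For $q\in\mathbb{P}$, a condition $\bar q\in M\cap\mathbb{P}$ is a residue of $q$ to $M$ if every $s\le\bar q$ with $s\in M$ is compatible with $q$. A condition $p\in\mathbb{P}$ is $(M,\mathbb{P})$-strongly generic if every $q\le p$ has a residue to $M$. $\mathbb{P}$ is strongly proper for $M$ if every $s\in M\cap\mathbb{P}$ can be extended to an $(M,\mathbb{P})$-strongly generic condition. Preservation. If $G$ is $V$-generic over $\mathbb{P}$, then $\tau^G$ denotes the topology on $X$ in $V[G]$ having $\tau$ as a basis. "$\mathbb{P}$ forces that $(X,\tau)$ has property $\Phi$" means that every condition forces that $(X,\tau^{\dot G})$ has property $\Phi$. A space is Lindelöf if every open cover has a countable subcover (no separation axioms are assumed). *)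

theory Defs
  imports "HOL-Analysis.Analysis"
begin

unbundle cardinal_syntax

section \<open>The universe of sets\<close>

text \<open>A type of this class is a universe of sets satisfying ZFC, with separation and replacement
  for arbitrary HOL predicates and functions; choice is inherited from HOL.
  HOL sets over the type play the role of classes.\<close>

class zfc_universe =
  fixes elts :: "'a \<Rightarrow> 'a set"
  assumes extensionality: "elts x = elts y \<Longrightarrow> x = y"
    and foundation: "wf {(x, y). x \<in> elts y}"
    and pairing: "\<exists>z. elts z = {x, y}"
    and union: "\<exists>z. elts z = (\<Union>y\<in>elts x. elts y)"
    and power_set: "\<exists>z. elts z = {y. elts y \<subseteq> elts x}"
    and separation: "\<exists>z. elts z = {y \<in> elts x. \<phi> y}"
    and replacement: "\<exists>z. elts z = f ` elts x"
    and infinity: "\<exists>w. (\<exists>e\<in>elts w. elts e = {}) \<and>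
                       (\<forall>x\<in>elts w. \<exists>y\<in>elts w. elts y = insert x (elts x))"

text \<open>The set with a given extension; unspecified for proper classes.\<close>

definition vset :: "'a::zfc_universe set \<Rightarrow> 'a" where
  "vset A = (THE x. elts x = A)"

definition kpair :: "'a::zfc_universe \<Rightarrow> 'a \<Rightarrow> 'a" where
  "kpair x y = vset {vset {x}, vset {x, y}}"

definition vprod :: "'a::zfc_universe \<Rightarrow> 'a \<Rightarrow> 'a" where
  "vprod x y = vset {kpair a b | a b. a \<in> elts x \<and> b \<in> elts y}"

definition vpow :: "'a::zfc_universe \<Rightarrow> 'a" where
  "vpow x = vset {y. elts y \<subseteq> elts x}"

definition vrel :: "'a::zfc_universe \<Rightarrow> 'a rel" where
  "vrel R = {(x, y). kpair x y \<in> elts R}"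

definition codes_topology :: "'a::zfc_universe \<Rightarrow> 'a \<Rightarrow> 'a topology \<Rightarrow> bool" where
  "codes_topology X \<tau> T \<longleftrightarrow> elts X = topspace T \<and> elts ` elts \<tau> = {U. openin T U}"

definition is_poset :: "'a::zfc_universe \<Rightarrow> 'a \<Rightarrow> bool" where
  "is_poset P R \<longleftrightarrow> elts R \<subseteq> {kpair p q | p q. True} \<and> partial_order_on (elts P) (vrel R)"


section \<open>Sets hereditarily of cardinality less than a cardinal\<close>

definition trcl :: "'a::zfc_universe \<Rightarrow> 'a set" where
  "trcl x = {y. (y, x) \<in> {(u, v). u \<in> elts v}\<^sup>+}"

definition H :: "'k rel \<Rightarrow> 'a::zfc_universe set" where
  "H \<theta> = {x. |trcl x| <o \<theta>}"

text \<open>Up to replacing ground model sets by their canonical names, the subsets of \<open>\<tau> \<times> P\<close>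
  are the nice names for subfamilies of \<open>\<tau>\<close>; similarly for \<open>X \<times> P\<close>.\<close>

definition large_enough ::
    "'k rel \<Rightarrow> 'a::zfc_universe \<Rightarrow> 'a \<Rightarrow> 'a \<Rightarrow> 'a \<Rightarrow> bool" where
  "large_enough \<theta> X \<tau> P R \<longleftrightarrow>
     cardSuc (cardSuc natLeq) \<le>o \<theta> \<and>
     {X, \<tau>, P, R, vpow X, vpow \<tau>, vpow P, vpow (vprod X P), vpow (vprod \<tau> P)} \<subseteq> H \<theta>"


section \<open>Formulas of set theory\<close>

datatype fm = FMem nat nat | FEq nat nat | FNeg fm | FAnd fm fm | FAll nat fm

primrec sat :: "'a::zfc_universe set \<Rightarrow> fm \<Rightarrow> (nat \<Rightarrow> 'a) \<Rightarrow> bool" where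
  "sat M (FMem x y) e \<longleftrightarrow> e x \<in> elts (e y)"
| "sat M (FEq x y) e \<longleftrightarrow> e x = e y"
| "sat M (FNeg \<phi>) e \<longleftrightarrow> \<not> sat M \<phi> e"
| "sat M (FAnd \<phi> \<psi>) e \<longleftrightarrow> sat M \<phi> e \<and> sat M \<psi> e"
| "sat M (FAll x \<phi>) e \<longleftrightarrow> (\<forall>a\<in>M. sat M \<phi> (e(x := a)))"

definition elementary_submodel :: "'a::zfc_universe set \<Rightarrow> 'a set \<Rightarrow> bool" where
  "elementary_submodel M N \<longleftrightarrow> M \<noteq> {} \<and> M \<subseteq> N \<and>
     (\<forall>\<phi> e. range e \<subseteq> M \<longrightarrow> (sat M \<phi> e \<longleftrightarrow> sat N \<phi> e))"

abbreviation FOr :: "fm \<Rightarrow> fm \<Rightarrow> fm" where "FOr \<phi> \<psi> \<equiv> FNeg (FAnd (FNeg \<phi>) (FNeg \<psi>))"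
abbreviation FImp :: "fm \<Rightarrow> fm \<Rightarrow> fm" where "FImp \<phi> \<psi> \<equiv> FNeg (FAnd \<phi> (FNeg \<psi>))"
abbreviation FIff :: "fm \<Rightarrow> fm \<Rightarrow> fm" where "FIff \<phi> \<psi> \<equiv> FAnd (FImp \<phi> \<psi>) (FImp \<psi> \<phi>)"
abbreviation FEx :: "nat \<Rightarrow> fm \<Rightarrow> fm" where "FEx x \<phi> \<equiv> FNeg (FAll x (FNeg \<phi>))"
abbreviation FBall :: "nat \<Rightarrow> nat \<Rightarrow> fm \<Rightarrow> fm" where "FBall x y \<phi> \<equiv> FAll x (FImp (FMem x y) \<phi>)"
abbreviation FBex :: "nat \<Rightarrow> nat \<Rightarrow> fm \<Rightarrow> fm" where "FBex x y \<phi> \<equiv> FEx x (FAnd (FMem x y) \<phi>)"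

text \<open>Variables are named by numbers and nothing is renamed: each formula below binds its own
  variables, numbered from 20 on, and is only applied to variables that it does not bind.\<close>

definition subset_fm :: "nat \<Rightarrow> nat \<Rightarrow> fm" where
  "subset_fm x y = FBall 20 x (FMem 20 y)"

definition upair_fm :: "nat \<Rightarrow> nat \<Rightarrow> nat \<Rightarrow> fm" where
  "upair_fm z x y = FAll 21 (FIff (FMem 21 z) (FOr (FEq 21 x) (FEq 21 y)))"

definition kpair_fm :: "nat \<Rightarrow> nat \<Rightarrow> nat \<Rightarrow> fm" where
  "kpair_fm z x y = FAll 22 (FIff (FMem 22 z) (FOr (upair_fm 22 x x) (upair_fm 22 x y)))"

definition inductive_fm :: "nat \<Rightarrow> fm" where
  "inductive_fm w =
     FAnd (FBex 23 w (FAll 24 (FNeg (FMem 24 23))))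
          (FBall 23 w (FBex 25 w (FAll 24 (FIff (FMem 24 25) (FOr (FMem 24 23) (FEq 24 23))))))"

definition omega_fm :: "nat \<Rightarrow> fm" where
  "omega_fm w = FAnd (inductive_fm w) (FAll 26 (FImp (inductive_fm 26) (subset_fm w 26)))"

text \<open>\<open>W\<close> is countable: some function \<open>f\<close> (variable 28) from a subset of \<open>\<omega>\<close> (variable 27)
  has range \<open>W\<close>.\<close>

definition countable_fm :: "nat \<Rightarrow> fm" where
  "countable_fm W =
     FEx 27 (FEx 28 (FAnd (omega_fm 27)
       (FAnd (FBall 29 28 (FBex 30 27 (FBex 31 W (kpair_fm 29 30 31))))
       (FAnd (FAll 30 (FAll 31 (FAll 32 (FBall 29 28 (FBall 33 28
                (FImp (FAnd (kpair_fm 29 30 31) (kpair_fm 33 30 32)) (FEq 31 32)))))))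
             (FBall 31 W (FBex 30 27 (FBex 29 28 (kpair_fm 29 30 31))))))))"

text \<open>\<open>u\<close> is open in the topology with basis \<open>t\<close>, i.e. the union of some \<open>s \<subseteq> t\<close> (variable 34).\<close>

definition open_fm :: "nat \<Rightarrow> nat \<Rightarrow> fm" where
  "open_fm u t = FEx 34 (FAnd (subset_fm 34 t)
                   (FAll 35 (FIff (FMem 35 u) (FBex 36 34 (FMem 35 36)))))"

definition covers_fm :: "nat \<Rightarrow> nat \<Rightarrow> fm" where
  "covers_fm U x = FBall 37 x (FBex 38 U (FMem 37 38))"

text \<open>The space with set of points \<open>x\<close> and basis \<open>t\<close> is Lindelof.\<close>

definition Lindelof_fm :: "nat \<Rightarrow> nat \<Rightarrow> fm" where
  "Lindelof_fm x t =
     FAll 39 (FImp (FAnd (FBall 40 39 (open_fm 40 t)) (covers_fm 39 x))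
       (FEx 41 (FAnd (subset_fm 41 39) (FAnd (countable_fm 41) (covers_fm 41 x)))))"


section \<open>Forcing\<close>

text \<open>A poset is given by its underlying set \<open>P\<close> and its order \<open>R\<close>, a set of pairs;
  stronger conditions are smaller.\<close>

abbreviation leq :: "'a::zfc_universe \<Rightarrow> 'a \<Rightarrow> 'a \<Rightarrow> bool" where
  "leq R p q \<equiv> (p, q) \<in> vrel R"

inductive is_name :: "'a::zfc_universe \<Rightarrow> 'a \<Rightarrow> bool" for P where
  "(\<And>z. z \<in> elts a \<Longrightarrow> \<exists>s p. z = kpair s p \<and> is_name P s \<and> p \<in> elts P) \<Longrightarrow> is_name P a"

text \<open>The canonical name of a ground model set. As no largest condition is assumed, every
  condition is attached to every element.\<close>

function check :: "'a::zfc_universe \<Rightarrow> 'a \<Rightarrow> 'a" where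
  "check P x = vset (\<Union>y\<in>elts x. {kpair (check P y) p | p. p \<in> elts P})"
  by auto
termination
  by (relation "inv_image {(x, y). x \<in> elts y} snd") (auto simp: foundation)

text \<open>The usual recursion for \<open>p \<tturnstile> a = b\<close>. It is well-founded in the pair of names, so
  that the least fixed point defined here is the only one.\<close>

inductive forces_eq :: "'a::zfc_universe \<Rightarrow> 'a \<Rightarrow> 'a \<Rightarrow> 'a \<Rightarrow> bool" for R where
  "\<lbrakk>\<And>s r q. \<lbrakk>kpair s r \<in> elts a; leq R q p; leq R q r\<rbrakk> \<Longrightarrow>
      \<exists>q' s' r'. leq R q' q \<and> kpair s' r' \<in> elts b \<and> leq R q' r' \<and> forces_eq R q' s s';
    \<And>s r q. \<lbrakk>kpair s r \<in> elts b; leq R q p; leq R q r\<rbrakk> \<Longrightarrow>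
      \<exists>q' s' r'. leq R q' q \<and> kpair s' r' \<in> elts a \<and> leq R q' r' \<and> forces_eq R q' s' s\<rbrakk>
   \<Longrightarrow> forces_eq R p a b"

definition forces_mem :: "'a::zfc_universe \<Rightarrow> 'a \<Rightarrow> 'a \<Rightarrow> 'a \<Rightarrow> bool" where
  "forces_mem R p a b \<longleftrightarrow>
     (\<forall>q. leq R q p \<longrightarrow>
       (\<exists>q' s r. leq R q' q \<and> kpair s r \<in> elts b \<and> leq R q' r \<and> forces_eq R q' a s))"

primrec forces :: "'a::zfc_universe \<Rightarrow> 'a \<Rightarrow> 'a \<Rightarrow> fm \<Rightarrow> (nat \<Rightarrow> 'a) \<Rightarrow> bool" where
  "forces P R p (FMem x y) e \<longleftrightarrow> forces_mem R p (e x) (e y)"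
| "forces P R p (FEq x y) e \<longleftrightarrow> forces_eq R p (e x) (e y)"
| "forces P R p (FNeg \<phi>) e \<longleftrightarrow> (\<forall>q. leq R q p \<longrightarrow> \<not> forces P R q \<phi> e)"
| "forces P R p (FAnd \<phi> \<psi>) e \<longleftrightarrow> forces P R p \<phi> e \<and> forces P R p \<psi> e"
| "forces P R p (FAll x \<phi>) e \<longleftrightarrow> (\<forall>a. is_name P a \<longrightarrow> forces P R p \<phi> (e(x := a)))"

definition forces_Lindelof :: "'a::zfc_universe \<Rightarrow> 'a \<Rightarrow> 'a \<Rightarrow> 'a \<Rightarrow> bool" where
  "forces_Lindelof P R X \<tau> \<longleftrightarrow>
     (\<forall>p\<in>elts P. \<forall>e. e 0 = check P X \<and> e 1 = check P \<tau> \<longrightarrow> forces P R p (Lindelof_fm 0 1) e)"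


section \<open>Strong properness\<close>

definition compatible :: "'a::zfc_universe \<Rightarrow> 'a \<Rightarrow> 'a \<Rightarrow> bool" where
  "compatible R p q \<longleftrightarrow> (\<exists>r. leq R r p \<and> leq R r q)"

definition residue :: "'a::zfc_universe \<Rightarrow> 'a \<Rightarrow> 'a set \<Rightarrow> 'a \<Rightarrow> 'a \<Rightarrow> bool" where
  "residue P R M q q' \<longleftrightarrow>
     q' \<in> M \<inter> elts P \<and> (\<forall>s\<in>M. leq R s q' \<longrightarrow> compatible R s q)"

definition strongly_generic :: "'a::zfc_universe \<Rightarrow> 'a \<Rightarrow> 'a set \<Rightarrow> 'a \<Rightarrow> bool" where
  "strongly_generic P R M p \<longleftrightarrow>
     p \<in> elts P \<and> (\<forall>q. leq R q p \<longrightarrow> (\<exists>q'. residue P R M q q'))"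

definition strongly_proper_for :: "'a::zfc_universe \<Rightarrow> 'a \<Rightarrow> 'a set \<Rightarrow> bool" where
  "strongly_proper_for P R M \<longleftrightarrow>
     (\<forall>s \<in> M \<inter> elts P. \<exists>p. leq R p s \<and> strongly_generic P R M p)"


section \<open>Stationary sets of countable sets\<close>

definition ctbl_subsets :: "'b set \<Rightarrow> 'b set set" where
  "ctbl_subsets A = {M. M \<subseteq> A \<and> |M| =o natLeq}"

definition club :: "'b set \<Rightarrow> 'b set set \<Rightarrow> bool" where
  "club A C \<longleftrightarrow> C \<subseteq> ctbl_subsets A \<and>
     (\<forall>M\<in>ctbl_subsets A. \<exists>N\<in>C. M \<subseteq> N) \<and>
     (\<forall>N :: nat \<Rightarrow> 'b set. incseq N \<and> range N \<subseteq> C \<longrightarrow> (\<Union>n. N n) \<in> C)"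

definition stationary :: "'b set \<Rightarrow> 'b set set \<Rightarrow> bool" where
  "stationary A S \<longleftrightarrow> S \<subseteq> ctbl_subsets A \<and> (\<forall>C. club A C \<longrightarrow> S \<inter> C \<noteq> {})"

end

(* Let q force that U is an open cover. For t below q, the sets B in \<tau> such that some r below t and
   some name u satisfy that r forces u to be an element of U containing B form an open cover of X in
   the ground model; a countable subcover yields a countable set A t of such pairs (r, u). Take M in
   the given stationary set which contains q and is closed under t |-> fst ` A t and under a choice of
   common extensions with q. A strongly generic p below q forces that the names u with (r, u) in A t,
   t in M and r generic cover X: a condition s below p has a residue s0 to M, some t in M is below s0
   and q, and any r in M below t is compatible with s. Closing M under these countable-valued functions,
   which is a club condition, replaces every use of the elementarity of M. *)

theory Submission
  imports Defs "HOL-Library.Countable_Set_Type"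
begin

text \<open>The cover U is an arbitrary name that need not belong to M or even to
  \<open>H \<theta>\<close>. Hence M is closed only under functions whose values are sets of
  conditions; the names u stay outside M and are recovered through A. The pairs record u because the
  subcover must consist of members of U, while the basic set B inside u need not be one. All the
  pairs collected over M form a countable set in the ground model. Only the choice of those with a
  generic first component depends on the generic, so an enumeration in the ground model also shows
  that the subcover is countable in the extension. A t is meaningful only for t below q, but a
  residue of s need not lie below q. It is compatible with s, hence with q, and this is where the
  common extensions come from. The argument stays inside the forcing relation: no generic filter is
  taken, existential statements are decided only densely, and each object claimed by the formula
  needs an explicit name.\<close>

section \<open>Sets and classes\<close>

text \<open>\<open>vset\<close> is a definite description and has the intended value only on HOL
  sets that are extensions of elements of the universe; each name built below needs a proof of
  this.\<close>

definition small :: "'a::zfc_universe set \<Rightarrow> bool" where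
  "small A \<longleftrightarrow> (\<exists>x. elts x = A)"

lemma elts_vset:
  assumes "small A" shows "elts (vset A) = A"
proof -
  obtain x where x: "elts x = A" using assms unfolding small_def by (rule exE)
  show ?thesis
    unfolding vset_def
  proof (rule theI)
    show "elts x = A" by (rule x)
    show "y = x" if "elts y = A" for y
      by (rule extensionality) (simp add: that x)
  qed
qed

lemma small_elts [simp]: "small (elts x)"
  unfolding small_def by (rule exI) (rule refl)

lemma small_image:
  fixes f :: "'a::zfc_universe \<Rightarrow> 'a"
  assumes "small A" shows "small (f ` A)"
proof -
  obtain x where "elts x = A" using assms unfolding small_def by (rule exE)
  then show ?thesis unfolding small_def using replacement[of f x] by simp
qed

lemma small_subset:
  assumes "small A" "B \<subseteq> A" shows "small B"
proof -
  obtain x where "elts x = A" using assms by (auto simp: small_def)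
  then have "B = {y \<in> elts x. y \<in> B}" using assms by auto
  then show ?thesis unfolding small_def using separation[of x "\<lambda>y. y \<in> B"] by simp
qed

lemma small_doubleton [simp]: "small {x, y}"
  unfolding small_def by (rule pairing)

lemma small_singleton [simp]: "small {x}"
  using small_doubleton[of x x] by simp

lemma small_empty [simp]: "small {}"
  using small_subset[OF small_singleton] by blast

text \<open>Replacement collects the codes of the sets \<open>B x\<close> into one set, and the
  union axiom flattens it.\<close>

lemma small_UN:
  fixes B :: "'a::zfc_universe \<Rightarrow> 'a set"
  assumes "small A" "\<And>x. x \<in> A \<Longrightarrow> small (B x)"
  shows "small (\<Union>x\<in>A. B x)"
proof -
  obtain a where a: "elts a = (\<lambda>x. vset (B x)) ` A"
    using small_image[OF assms(1), of "\<lambda>x. vset (B x)"] unfolding small_def by (rule exE)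
  obtain z where "elts z = (\<Union>y\<in>elts a. elts y)"
    using union[of a] by (rule exE)
  also have "\<dots> = (\<Union>x\<in>A. B x)" using assms(2) by (simp add: a elts_vset)
  finally show ?thesis unfolding small_def by (rule exI)
qed

lemma small_insert:
  assumes "small A" shows "small (insert x A)"
  using small_UN[of "{vset {x}, vset A}" elts, OF small_doubleton small_elts] assms
  by (simp add: elts_vset)

lemma elts_kpair: "elts (kpair x y) = {vset {x}, vset {x, y}}"
  by (simp add: kpair_def elts_vset)

lemma kpair_inject [simp]: "kpair a b = kpair c d \<longleftrightarrow> a = c \<and> b = d"
proof
  have eq: "vset A = vset B \<longleftrightarrow> A = B" if "small A" "small B" for A B :: "'a set"
    using that by (metis elts_vset)
  assume "kpair a b = kpair c d"
  then have "{vset {a}, vset {a, b}} = {vset {c}, vset {c, d}}"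
    by (metis elts_kpair)
  then show "a = c \<and> b = d"
    by (simp add: doubleton_eq_iff eq) metis
qed simp

text \<open>\<open>s\<close> lies three membership steps below \<open>a\<close>: it is in its
  singleton, which is in the pair, which is in \<open>a\<close>. Hence the induction runs over the
  transitive closure of membership.\<close>

lemma name_induct [case_names less]:
  assumes "\<And>a. (\<And>s r. kpair s r \<in> elts a \<Longrightarrow> Q s) \<Longrightarrow> Q a"
  shows "Q (a::'a::zfc_universe)"
proof (induction a rule: wf_induct_rule[OF wf_trancl[OF foundation]])
  case (1 a)
  show ?case
  proof (rule assms)
    fix s r assume "kpair s r \<in> elts a"
    then have "(kpair s r, a) \<in> {(x, y). x \<in> elts y}" by simp
    moreover have "(vset {s}, kpair s r) \<in> {(x, y). x \<in> elts y}" by (simp add: elts_kpair)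
    moreover have "(s, vset {s}) \<in> {(x, y). x \<in> elts y}" by (simp add: elts_vset)
    ultimately have "(s, a) \<in> {(x, y). x \<in> elts y}\<^sup>+"
      by (blast intro: r_into_trancl trancl_into_trancl)
    then show "Q s" by (rule 1)
  qed
qed

lemma elts_induct [case_names less]:
  assumes "\<And>a. (\<And>s. s \<in> elts a \<Longrightarrow> Q s) \<Longrightarrow> Q a"
  shows "Q (a::'a::zfc_universe)"
  by (rule wf_induct_rule[OF foundation]) (use assms in auto)

section \<open>Von Neumann numerals and countable sets\<close>

primrec vnat :: "nat \<Rightarrow> 'a::zfc_universe" where
  "vnat 0 = vset {}"
| "vnat (Suc n) = vset (insert (vnat n) (elts (vnat n)))"

lemma elts_vnat_0: "elts (vnat 0) = {}"
  by (simp add: elts_vset)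

lemma elts_vnat_Suc: "elts (vnat (Suc n)) = insert (vnat n) (elts (vnat n))"
  by (simp add: elts_vset small_insert)

lemma vnat_mem: "m < n \<Longrightarrow> vnat m \<in> elts (vnat n)"
  by (induction n) (auto simp: elts_vnat_Suc less_Suc_eq simp del: vnat.simps)

lemma inj_vnat: "inj (vnat :: nat \<Rightarrow> 'a::zfc_universe)"
proof (rule linorder_injI)
  have "x \<notin> elts x" for x :: 'a
    using foundation by (auto dest: wf_not_refl)
  then show "vnat m \<noteq> (vnat n :: 'a)" if "m < n" for m n
    using vnat_mem[OF that] by metis
qed

text \<open>An inductive set contains every numeral, because extensionality identifies its zero and
  its successors with the numerals.\<close>

lemma small_range_vnat: "small (range (vnat :: nat \<Rightarrow> 'a::zfc_universe))"
proof -
  obtain w :: 'a where w: "\<exists>e\<in>elts w. elts e = {}"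
    "\<forall>x\<in>elts w. \<exists>y\<in>elts w. elts y = insert x (elts x)"
    using infinity by blast
  have "vnat n \<in> elts w" for n
  proof (induction n)
    case 0
    then show ?case using w(1) elts_vnat_0 extensionality by metis
  next
    case (Suc n)
    then show ?case using w(2) elts_vnat_Suc extensionality by metis
  qed
  then show ?thesis by (intro small_subset[OF small_elts[of w]]) auto
qed

text \<open>An enumeration of \<open>A\<close> becomes a function on the set of numerals, and
  replacement applies. This allows countable HOL sets to be turned into names.\<close>

lemma countable_imp_small:
  fixes A :: "'a::zfc_universe set"
  assumes "countable A" shows "small A"
proof (cases "A = {}")
  case False
  have "A = range (from_nat_into A)"
    using assms False by (simp add: range_from_nat_into)
  also have "\<dots> = (\<lambda>x. from_nat_into A (inv (vnat :: nat \<Rightarrow> 'a) x)) ` range vnat"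
    by (simp add: image_image inv_f_f[OF inj_vnat])
  finally have "A = (\<lambda>x. from_nat_into A (inv (vnat :: nat \<Rightarrow> 'a) x)) ` range vnat" .
  moreover have "small \<dots>"
    by (rule small_image[OF small_range_vnat])
  ultimately show ?thesis by (rule ssubst)
qed simp

definition vomega :: "'a::zfc_universe" where
  "vomega = vset (range vnat)"

lemma elts_vomega: "elts vomega = range vnat"
  by (simp add: vomega_def elts_vset small_range_vnat)


section \<open>Stationary sets\<close>

text \<open>\<open>ctbl_subsets\<close> asks for size exactly aleph_0, so infinitude has to be
  tracked along with countability.\<close>

lemma ordIso_natLeq_iff: "|A| =o natLeq \<longleftrightarrow> countable A \<and> infinite A"
  using infinite_iff_natLeq_ordLeq[of A]
  by (simp add: ordIso_iff_ordLeq countable_card_le_natLeq)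

text \<open>Unboundedness comes from closing off omega many times. Unions of chains stay closed
  because \<open>F\<close> acts on single points, so a stage containing \<open>x\<close> already
  contains \<open>F x\<close>.\<close>

lemma club_closed:
  assumes F: "\<And>x. x \<in> A \<Longrightarrow> F x \<subseteq> A \<and> countable (F x)"
  shows "club A {M \<in> ctbl_subsets A. \<forall>x\<in>M. F x \<subseteq> M}"
  unfolding club_def
proof (intro conjI ballI allI impI)
  fix M assume M: "M \<in> ctbl_subsets A"
  define N where "N n = ((\<lambda>S. S \<union> (\<Union>x\<in>S. F x)) ^^ n) M" for n
  have N: "N n \<subseteq> A \<and> countable (N n)" for n
  proof (induction n)
    case 0
    then show ?case using M by (simp add: N_def ctbl_subsets_def ordIso_natLeq_iff)
  next
    case (Suc n)
    have "N (Suc n) = N n \<union> (\<Union>x\<in>N n. F x)" by (simp add: N_def)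
    moreover have "countable (\<Union>x\<in>N n. F x)"
      using Suc F by (intro countable_UN) blast+
    moreover have "(\<Union>x\<in>N n. F x) \<subseteq> A" using Suc F by blast
    ultimately show ?case using Suc by simp
  qed
  have "M = N 0" by (simp add: N_def)
  then have MN: "M \<subseteq> (\<Union>n. N n)" by blast
  moreover have "infinite M" using M by (simp add: ctbl_subsets_def ordIso_natLeq_iff)
  ultimately have "infinite (\<Union>n. N n)" by (rule infinite_super)
  with N have "(\<Union>n. N n) \<in> ctbl_subsets A"
    by (auto simp: ctbl_subsets_def ordIso_natLeq_iff)
  moreover have "F x \<subseteq> (\<Union>n. N n)" if x: "x \<in> (\<Union>n. N n)" for x
  proof -
    obtain n where "x \<in> N n" using x by blast
    then have "F x \<subseteq> N (Suc n)" by (auto simp: N_def)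
    then show ?thesis by blast
  qed
  ultimately show "\<exists>N\<in>{M \<in> ctbl_subsets A. \<forall>x\<in>M. F x \<subseteq> M}. M \<subseteq> N"
    using MN by blast
next
  fix N :: "nat \<Rightarrow> 'a set"
  assume N: "incseq N \<and> range N \<subseteq> {M \<in> ctbl_subsets A. \<forall>x\<in>M. F x \<subseteq> M}"
  have N1: "N n \<subseteq> A \<and> countable (N n) \<and> infinite (N n) \<and> (\<forall>x\<in>N n. F x \<subseteq> N n)" for n
  proof -
    have "N n \<in> {M \<in> ctbl_subsets A. \<forall>x\<in>M. F x \<subseteq> M}" using N by blast
    then show ?thesis by (simp add: ctbl_subsets_def ordIso_natLeq_iff)
  qed
  have "N 0 \<subseteq> (\<Union>n. N n)" by blast
  then have "infinite (\<Union>n. N n)" by (rule infinite_super) (simp add: N1)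
  moreover have "\<forall>x\<in>(\<Union>n. N n). F x \<subseteq> (\<Union>n. N n)"
  proof
    fix x assume "x \<in> (\<Union>n. N n)"
    then obtain n where "x \<in> N n" by blast
    then have "F x \<subseteq> N n" using N1[of n] by blast
    then show "F x \<subseteq> (\<Union>n. N n)" by blast
  qed
  moreover have "(\<Union>n. N n) \<subseteq> A" by (rule UN_least) (simp add: N1)
  moreover have "countable (\<Union>n. N n)" using N1 by simp
  ultimately show "(\<Union>n. N n) \<in> {M \<in> ctbl_subsets A. \<forall>x\<in>M. F x \<subseteq> M}"
    by (simp add: ctbl_subsets_def ordIso_natLeq_iff)
qed blast

text \<open>Transitive closures shrink when passing to members. Applied to \<open>P\<close>, this
  puts all conditions into \<open>H \<theta>\<close>, where functions valued in sets of conditions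
  then define a club.\<close>

lemma elts_subset_H:
  assumes "x \<in> H \<theta>" shows "elts x \<subseteq> H \<theta>"
proof
  fix y assume y: "y \<in> elts x"
  have "trcl y \<subseteq> trcl x"
    unfolding trcl_def using y by (auto intro: trancl_into_trancl)
  then show "y \<in> H \<theta>"
    using assms ordLeq_ordLess_trans[OF card_of_mono1] unfolding H_def by blast
qed


section \<open>The forcing relation\<close>

locale poset_forcing =
  fixes P R :: "'v::zfc_universe"
  assumes poset: "is_poset P R"
begin

lemma poset_rel: "vrel R \<subseteq> elts P \<times> elts P" "refl_on (elts P) (vrel R)" "trans (vrel R)"
  using poset unfolding is_poset_def partial_order_on_def preorder_on_def by blast+

lemma leq_in: "leq R p q \<Longrightarrow> p \<in> elts P \<and> q \<in> elts P"
  using poset_rel(1) by blast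

lemma leq_refl [simp]: "p \<in> elts P \<Longrightarrow> leq R p p"
  using poset_rel(2) by (rule refl_onD)

lemma leq_trans: "leq R p q \<Longrightarrow> leq R q r \<Longrightarrow> leq R p r"
  using poset_rel(3) by (rule transD)

text \<open>The order is reflexive only on \<open>elts P\<close>, and lying below something
  certifies membership there. This serves to instantiate quantifiers over extensions at the
  condition itself.\<close>

lemma leq_refl_left: "leq R p q \<Longrightarrow> leq R p p"
  using leq_in by simp

lemma forces_eqD1:
  assumes "forces_eq R p a b" "kpair s r \<in> elts a" "leq R q p" "leq R q r"
  obtains q' s' r' where "leq R q' q" "kpair s' r' \<in> elts b" "leq R q' r'" "forces_eq R q' s s'"
  using assms(1)
proof cases
  case 1
  from 1(1)[OF assms(2-4)] that show ?thesis by (elim exE conjE)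
qed

lemma forces_eqD2:
  assumes "forces_eq R p a b" "kpair s r \<in> elts b" "leq R q p" "leq R q r"
  obtains q' s' r' where "leq R q' q" "kpair s' r' \<in> elts a" "leq R q' r'" "forces_eq R q' s' s"
  using assms(1)
proof cases
  case 1
  from 1(2)[OF assms(2-4)] that show ?thesis by (elim exE conjE)
qed

section \<open>Forced equality of names\<close>

lemma forces_eq_mono:
  assumes "forces_eq R p a b" "leq R q p" shows "forces_eq R q a b"
proof (rule forces_eq.intros)
  fix s r q1 assume A: "kpair s r \<in> elts a" "leq R q1 q" "leq R q1 r"
  show "\<exists>q' s' r'. leq R q' q1 \<and> kpair s' r' \<in> elts b \<and> leq R q' r' \<and> forces_eq R q' s s'"
    by (rule forces_eqD1[OF assms(1) A(1) leq_trans[OF A(2) assms(2)] A(3)]) blast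
next
  fix s r q1 assume A: "kpair s r \<in> elts b" "leq R q1 q" "leq R q1 r"
  show "\<exists>q' s' r'. leq R q' q1 \<and> kpair s' r' \<in> elts a \<and> leq R q' r' \<and> forces_eq R q' s' s"
    by (rule forces_eqD2[OF assms(1) A(1) leq_trans[OF A(2) assms(2)] A(3)]) blast
qed

text \<open>The clauses for equality ask only for some stronger \<open>q'\<close>, so one may first
  pass to a condition that forces the equality.\<close>

lemma forces_eq_dense:
  assumes "\<And>q. leq R q p \<Longrightarrow> \<exists>r. leq R r q \<and> forces_eq R r a b"
  shows "forces_eq R p a b"
proof (rule forces_eq.intros)
  fix s r q assume A: "kpair s r \<in> elts a" "leq R q p" "leq R q r"
  obtain q1 where q1: "leq R q1 q" "forces_eq R q1 a b" using assms A by blast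
  show "\<exists>q' s' r'. leq R q' q \<and> kpair s' r' \<in> elts b \<and> leq R q' r' \<and> forces_eq R q' s s'"
    by (rule forces_eqD1[OF q1(2) A(1) leq_refl_left[OF q1(1)] leq_trans[OF q1(1) A(3)]])
      (blast intro: leq_trans[OF _ q1(1)])
next
  fix s r q assume A: "kpair s r \<in> elts b" "leq R q p" "leq R q r"
  obtain q1 where q1: "leq R q1 q" "forces_eq R q1 a b" using assms A by blast
  show "\<exists>q' s' r'. leq R q' q \<and> kpair s' r' \<in> elts a \<and> leq R q' r' \<and> forces_eq R q' s' s"
    by (rule forces_eqD2[OF q1(2) A(1) leq_refl_left[OF q1(1)] leq_trans[OF q1(1) A(3)]])
      (blast intro: leq_trans[OF _ q1(1)])
qed

lemma forces_eq_refl [simp]: "forces_eq R p a a"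
proof (induction a arbitrary: p rule: name_induct)
  case (less a)
  show ?case
    by (rule forces_eq.intros) (use less leq_refl_left in blast)+
qed

text \<open>Swapping the names swaps the two clauses of the definition; the induction hypothesis
  turns around the equalities between members.\<close>

lemma forces_eq_sym: "forces_eq R p a b \<Longrightarrow> forces_eq R p b a"
proof (induction rule: forces_eq.induct)
  case (1 a p b)
  show ?case
    by (rule forces_eq.intros) (use 1 in blast)+
qed

text \<open>Induction on the first name suffices, since in both clauses the equalities to be
  composed start at a member of \<open>a\<close>.\<close>

lemma forces_eq_trans: "forces_eq R p a b \<Longrightarrow> forces_eq R p b c \<Longrightarrow> forces_eq R p a c"
proof (induction a arbitrary: p b c rule: name_induct)
  case (less a)
  show ?case
  proof (rule forces_eq.intros)
    fix s r q assume A: "kpair s r \<in> elts a" "leq R q p" "leq R q r"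
    obtain q' s' r' where 1: "leq R q' q" "kpair s' r' \<in> elts b" "leq R q' r'" "forces_eq R q' s s'"
      using forces_eqD1[OF less.prems(1) A] .
    obtain q'' s'' r'' where 2: "leq R q'' q'" "kpair s'' r'' \<in> elts c" "leq R q'' r''"
      "forces_eq R q'' s' s''"
      using forces_eqD1[OF less.prems(2) 1(2) leq_trans[OF 1(1) A(2)] 1(3)] .
    have "forces_eq R q'' s s''"
      using less.IH[OF A(1) forces_eq_mono[OF 1(4) 2(1)] 2(4)] .
    with 2 leq_trans[OF 2(1) 1(1)]
    show "\<exists>q' s' r'. leq R q' q \<and> kpair s' r' \<in> elts c \<and> leq R q' r' \<and> forces_eq R q' s s'"
      by blast
  next
    fix s r q assume A: "kpair s r \<in> elts c" "leq R q p" "leq R q r"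
    obtain q' s' r' where 1: "leq R q' q" "kpair s' r' \<in> elts b" "leq R q' r'" "forces_eq R q' s' s"
      using forces_eqD2[OF less.prems(2) A] .
    obtain q'' s'' r'' where 2: "leq R q'' q'" "kpair s'' r'' \<in> elts a" "leq R q'' r''"
      "forces_eq R q'' s'' s'"
      using forces_eqD2[OF less.prems(1) 1(2) leq_trans[OF 1(1) A(2)] 1(3)] .
    have "forces_eq R q'' s'' s"
      using less.IH[OF 2(2) 2(4) forces_eq_mono[OF 1(4) 2(1)]] .
    with 2 leq_trans[OF 2(1) 1(1)]
    show "\<exists>q' s' r'. leq R q' q \<and> kpair s' r' \<in> elts a \<and> leq R q' r' \<and> forces_eq R q' s' s"
      by blast
  qed
qed

section \<open>Forced membership\<close>

lemma forces_memD:
  assumes "forces_mem R p a b" "leq R q p"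
  obtains q' s r where "leq R q' q" "kpair s r \<in> elts b" "leq R q' r" "forces_eq R q' a s"
  using assms unfolding forces_mem_def by blast

lemma forces_memI:
  assumes "\<And>q. leq R q p \<Longrightarrow>
    \<exists>q' s r. leq R q' q \<and> kpair s r \<in> elts b \<and> leq R q' r \<and> forces_eq R q' a s"
  shows "forces_mem R p a b"
  using assms unfolding forces_mem_def by blast

lemma forces_mem_mono:
  assumes "forces_mem R p a b" "leq R q p" shows "forces_mem R q a b"
  using assms leq_trans[OF _ assms(2)] unfolding forces_mem_def by blast

lemma forces_mem_dense:
  assumes "\<And>q. leq R q p \<Longrightarrow> \<exists>r. leq R r q \<and> forces_mem R r a b"
  shows "forces_mem R p a b"
proof (rule forces_memI)
  fix q assume "leq R q p"
  then obtain r where r: "leq R r q" "forces_mem R r a b" using assms by blast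
  obtain q' s r' where "leq R q' r" "kpair s r' \<in> elts b" "leq R q' r'" "forces_eq R q' a s"
    using forces_memD[OF r(2) leq_refl_left[OF r(1)]] .
  with leq_trans[OF _ r(1)]
  show "\<exists>q' s r. leq R q' q \<and> kpair s r \<in> elts b \<and> leq R q' r \<and> forces_eq R q' a s"
    by blast
qed

lemma forces_mem_eq1:
  assumes "forces_mem R p a b" "forces_eq R p a a'"
  shows "forces_mem R p a' b"
proof (rule forces_memI)
  fix q assume q: "leq R q p"
  obtain q' s r where 1: "leq R q' q" "kpair s r \<in> elts b" "leq R q' r" "forces_eq R q' a s"
    using forces_memD[OF assms(1) q] .
  have "forces_eq R q' a' s"
    using forces_eq_mono[OF assms(2) leq_trans[OF 1(1) q]] 1(4)
    by (blast intro: forces_eq_trans forces_eq_sym)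
  with 1 show "\<exists>q' s r. leq R q' q \<and> kpair s r \<in> elts b \<and> leq R q' r \<and> forces_eq R q' a' s"
    by blast
qed

lemma forces_mem_eq2:
  assumes "forces_mem R p a b" "forces_eq R p b b'"
  shows "forces_mem R p a b'"
proof (rule forces_memI)
  fix q assume q: "leq R q p"
  obtain q' s r where 1: "leq R q' q" "kpair s r \<in> elts b" "leq R q' r" "forces_eq R q' a s"
    using forces_memD[OF assms(1) q] .
  obtain q'' s' r' where 2: "leq R q'' q'" "kpair s' r' \<in> elts b'" "leq R q'' r'"
    "forces_eq R q'' s s'"
    using forces_eqD1[OF assms(2) 1(2) leq_trans[OF 1(1) q] 1(3)] .
  have "forces_eq R q'' a s'"
    using forces_eq_trans[OF forces_eq_mono[OF 1(4) 2(1)] 2(4)] .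
  with 2 leq_trans[OF 2(1) 1(1)]
  show "\<exists>q' s r. leq R q' q \<and> kpair s r \<in> elts b' \<and> leq R q' r \<and> forces_eq R q' a s"
    by blast
qed

lemma forces_mem_elts:
  assumes "kpair s r \<in> elts a" "leq R p r" shows "forces_mem R p s a"
proof (rule forces_memI)
  fix q assume q: "leq R q p"
  from assms(1) leq_refl_left[OF q] leq_trans[OF q assms(2)] forces_eq_refl
  show "\<exists>q' s' r. leq R q' q \<and> kpair s' r \<in> elts a \<and> leq R q' r \<and> forces_eq R q' s s'"
    by blast
qed

lemma is_name_elts: "is_name P a \<Longrightarrow> kpair s r \<in> elts a \<Longrightarrow> is_name P s \<and> r \<in> elts P"
  by (erule is_name.cases) fastforce

text \<open>Only names occurring in \<open>a\<close> or \<open>b\<close> have to be tested, each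
  below a condition attached to it.\<close>

lemma forces_eq_ext:
  assumes "is_name P a" "is_name P b"
    and "\<And>q c. leq R q p \<Longrightarrow> is_name P c \<Longrightarrow> forces_mem R q c a \<longleftrightarrow> forces_mem R q c b"
  shows "forces_eq R p a b"
proof (rule forces_eq.intros)
  fix s r q assume A: "kpair s r \<in> elts a" "leq R q p" "leq R q r"
  then have "forces_mem R q s b"
    using assms(3)[OF A(2)] is_name_elts[OF assms(1) A(1)] forces_mem_elts[OF A(1,3)] by blast
  then show "\<exists>q' s' r'. leq R q' q \<and> kpair s' r' \<in> elts b \<and> leq R q' r' \<and> forces_eq R q' s s'"
    unfolding forces_mem_def using leq_refl_left[OF A(2)] by blast
next
  fix s r q assume A: "kpair s r \<in> elts b" "leq R q p" "leq R q r"
  then have "forces_mem R q s a"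
    using assms(3)[OF A(2)] is_name_elts[OF assms(2) A(1)] forces_mem_elts[OF A(1,3)] by blast
  then show "\<exists>q' s' r'. leq R q' q \<and> kpair s' r' \<in> elts a \<and> leq R q' r' \<and> forces_eq R q' s' s"
    unfolding forces_mem_def using leq_refl_left[OF A(2)] forces_eq_sym by blast
qed

section \<open>Forcing of formulas\<close>

lemma forces_mono: "forces P R p \<phi> e \<Longrightarrow> leq R q p \<Longrightarrow> forces P R q \<phi> e"
proof (induction \<phi> arbitrary: e)
  case (FNeg \<phi>)
  then show ?case using leq_trans[OF _ FNeg.prems(2)] by simp
qed (auto intro: forces_mem_mono forces_eq_mono)

text \<open>In the negation case, a \<open>q\<close> forcing the formula would have an extension
  forcing both it and its negation. Later proofs may thus always pass to a stronger
  condition.\<close>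

lemma forces_dense:
  assumes "p \<in> elts P" "\<And>q. leq R q p \<Longrightarrow> \<exists>r. leq R r q \<and> forces P R r \<phi> e"
  shows "forces P R p \<phi> e"
  using assms(2)
proof (induction \<phi> arbitrary: e)
  case (FNeg \<phi>)
  show ?case
    unfolding forces.simps
  proof (intro allI impI notI)
    fix q assume q: "leq R q p" "forces P R q \<phi> e"
    with FNeg.prems obtain r where "leq R r q" "forces P R r (FNeg \<phi>) e" by blast
    then show False using forces_mono[OF q(2)] leq_refl_left unfolding forces.simps by blast
  qed
next
  case (FAnd \<phi> \<psi>)
  then show ?case unfolding forces.simps by blast
next
  case (FAll x \<phi>)
  then show ?case unfolding forces.simps by blast
next
  case (FMem x y)
  then show ?case unfolding forces.simps by (rule forces_mem_dense)
next
  case (FEq x y)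
  then show ?case unfolding forces.simps by (rule forces_eq_dense)
qed

lemma forces_FEx:
  "forces P R p (FEx x \<phi>) e \<longleftrightarrow>
    (\<forall>q. leq R q p \<longrightarrow> (\<exists>r a. leq R r q \<and> is_name P a \<and> forces P R r \<phi> (e(x := a))))"
  unfolding forces.simps by blast

lemma forces_FOr:
  "forces P R p (FOr \<phi> \<psi>) e \<longleftrightarrow>
    (\<forall>q. leq R q p \<longrightarrow> (\<exists>r. leq R r q \<and> (forces P R r \<phi> e \<or> forces P R r \<psi> e)))"
  unfolding forces.simps by blast

text \<open>Unfolding gives only densely many conditions that force the conclusion;
  \<open>forces_dense\<close> lifts this to \<open>q\<close> itself.\<close>

lemma forces_FImp:
  "forces P R p (FImp \<phi> \<psi>) e \<longleftrightarrow> (\<forall>q. leq R q p \<longrightarrow> forces P R q \<phi> e \<longrightarrow> forces P R q \<psi> e)"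
    (is "?l \<longleftrightarrow> ?r")
proof
  assume l: ?l
  show ?r
  proof (intro allI impI)
    fix q assume q: "leq R q p" "forces P R q \<phi> e"
    show "forces P R q \<psi> e"
    proof (rule forces_dense)
      show "q \<in> elts P" using q leq_in by blast
      fix q1 assume "leq R q1 q"
      with q have "leq R q1 p" "forces P R q1 \<phi> e" by (blast intro: leq_trans forces_mono)+
      with l show "\<exists>r. leq R r q1 \<and> forces P R r \<psi> e" unfolding forces.simps by blast
    qed
  qed
next
  assume ?r
  then show ?l unfolding forces.simps using leq_refl_left by blast
qed

lemma forces_FIff:
  "forces P R p (FIff \<phi> \<psi>) e \<longleftrightarrow> (\<forall>q. leq R q p \<longrightarrow> forces P R q \<phi> e \<longleftrightarrow> forces P R q \<psi> e)"
  by (subst forces.simps(4), subst (1 2) forces_FImp) blast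

text \<open>The bound \<open>y\<close> is read in the updated assignment, so no side condition on
  the variables arises; at concrete variables simplification evaluates it.\<close>

lemma forces_FBall:
  "forces P R p (FBall x y \<phi>) e \<longleftrightarrow>
    (\<forall>a q. is_name P a \<longrightarrow> leq R q p \<longrightarrow> forces_mem R q a ((e(x := a)) y) \<longrightarrow>
      forces P R q \<phi> (e(x := a)))"
  by (subst forces.simps(5), subst forces_FImp) auto

lemma forces_FBex:
  "forces P R p (FBex x y \<phi>) e \<longleftrightarrow>
    (\<forall>q. leq R q p \<longrightarrow> (\<exists>r a. leq R r q \<and> is_name P a \<and> forces_mem R r a ((e(x := a)) y) \<and>
      forces P R r \<phi> (e(x := a))))"
  by (subst forces_FEx) (simp only: forces.simps fun_upd_same)

lemma forces_FExI:
  assumes "is_name P a" "forces P R p \<phi> (e(x := a))" shows "forces P R p (FEx x \<phi>) e"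
  unfolding forces_FEx using assms forces_mono leq_refl_left by blast

lemma forces_FBexI:
  assumes "is_name P a" "forces_mem R p a ((e(x := a)) y)" "forces P R p \<phi> (e(x := a))"
  shows "forces P R p (FBex x y \<phi>) e"
  by (rule forces_FExI[OF assms(1)]) (simp only: forces.simps fun_upd_same assms simp_thms)

lemma forces_FBallI:
  assumes "\<And>a q. is_name P a \<Longrightarrow> leq R q p \<Longrightarrow> forces_mem R q a ((e(x := a)) y) \<Longrightarrow>
      \<exists>r. leq R r q \<and> forces P R r \<phi> (e(x := a))"
  shows "forces P R p (FBall x y \<phi>) e"
  unfolding forces_FBall
proof (intro allI impI)
  fix a q assume A: "is_name P a" "leq R q p" "forces_mem R q a ((e(x := a)) y)"
  show "forces P R q \<phi> (e(x := a))"
  proof (rule forces_dense)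
    show "q \<in> elts P" using leq_in[OF A(2)] by blast
    show "\<exists>r. leq R r q1 \<and> forces P R r \<phi> (e(x := a))" if "leq R q1 q" for q1
      using assms[OF A(1) leq_trans[OF that A(2)] forces_mem_mono[OF A(3) that]] .
  qed
qed

text \<open>As simp rules, the clauses for connectives would break up the derived connectives before
  their own lemmas apply, and the recursion of \<open>check\<close> would unfold without
  end.\<close>

declare forces.simps(3-5) [simp del] check.simps [simp del]

lemma forces_subset_fm:
  assumes "x \<noteq> 20" "y \<noteq> 20"
  shows "forces P R p (subset_fm x y) e \<longleftrightarrow>
    (\<forall>a q. is_name P a \<longrightarrow> leq R q p \<longrightarrow> forces_mem R q a (e x) \<longrightarrow> forces_mem R q a (e y))"
  unfolding subset_fm_def forces_FBall using assms by simp


section \<open>Names for pairs\<close>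

text \<open>This brings forced equality into the shape of the formulas that describe a set by its
  members, such as \<open>upair_fm\<close>, \<open>kpair_fm\<close> and the successor clause of
  \<open>inductive_fm\<close>.\<close>

lemma forces_eq_iff_ext:
  assumes "is_name P a" "is_name P b"
  shows "forces_eq R p a b \<longleftrightarrow>
    (\<forall>c q. is_name P c \<longrightarrow> leq R q p \<longrightarrow> forces_mem R q c a \<longleftrightarrow> forces_mem R q c b)"
proof
  assume "forces_eq R p a b"
  then show "\<forall>c q. is_name P c \<longrightarrow> leq R q p \<longrightarrow> forces_mem R q c a \<longleftrightarrow> forces_mem R q c b"
    by (blast intro: forces_mem_eq2 forces_eq_mono forces_eq_sym)
qed (blast intro: forces_eq_ext[OF assms])

text \<open>As in \<open>check\<close>, every condition is attached to both entries, in place of a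
  largest condition.\<close>

definition upname :: "'v \<Rightarrow> 'v \<Rightarrow> 'v" where
  "upname a b = vset (\<Union>c\<in>{a, b}. kpair c ` elts P)"

lemma elts_upname: "elts (upname a b) = (\<Union>c\<in>{a, b}. kpair c ` elts P)"
  unfolding upname_def by (rule elts_vset, rule small_UN[OF small_doubleton small_image[OF small_elts]])

lemma is_name_upname: "is_name P a \<Longrightarrow> is_name P b \<Longrightarrow> is_name P (upname a b)"
  by (rule is_name.intros) (auto simp: elts_upname)

lemma forces_mem_upname:
  "forces_mem R p c (upname a b) \<longleftrightarrow>
    (\<forall>q. leq R q p \<longrightarrow> (\<exists>r. leq R r q \<and> (forces_eq R r c a \<or> forces_eq R r c b)))"
proof -
  have "(\<exists>s r. leq R q' q \<and> kpair s r \<in> elts (upname a b) \<and> leq R q' r \<and> forces_eq R q' c s) \<longleftrightarrow>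
    leq R q' q \<and> (forces_eq R q' c a \<or> forces_eq R q' c b)" for q q'
    using leq_in[of q' q] leq_refl_left[of q' q] by (auto simp: elts_upname)
  then show ?thesis unfolding forces_mem_def by simp
qed

lemma forces_upair_fm:
  assumes "z \<noteq> 21" "x \<noteq> 21" "y \<noteq> 21" "is_name P (e z)" "is_name P (e x)" "is_name P (e y)"
  shows "forces P R p (upair_fm z x y) e \<longleftrightarrow> forces_eq R p (e z) (upname (e x) (e y))"
  unfolding forces_eq_iff_ext[OF assms(4) is_name_upname[OF assms(5,6)]] upair_fm_def
    forces.simps(5) forces_FIff
  unfolding forces_FOr forces_mem_upname
  using assms(1-3) by simp

text \<open>A name for the Kuratowski pair in the extension, in contrast to \<open>kpair\<close>,
  which pairs a name with a condition in the ground model.\<close>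

definition opname :: "'v \<Rightarrow> 'v \<Rightarrow> 'v" where
  "opname a b = upname (upname a a) (upname a b)"

lemma is_name_opname: "is_name P a \<Longrightarrow> is_name P b \<Longrightarrow> is_name P (opname a b)"
  by (simp add: opname_def is_name_upname)

lemma forces_kpair_fm:
  assumes "z \<notin> {21, 22}" "x \<notin> {21, 22}" "y \<notin> {21, 22}"
    "is_name P (e z)" "is_name P (e x)" "is_name P (e y)"
  shows "forces P R p (kpair_fm z x y) e \<longleftrightarrow> forces_eq R p (e z) (opname (e x) (e y))"
proof -
  have "forces P R q (upair_fm 22 x x) (e(22 := c)) \<longleftrightarrow> forces_eq R q c (upname (e x) (e x))"
    "forces P R q (upair_fm 22 x y) (e(22 := c)) \<longleftrightarrow> forces_eq R q c (upname (e x) (e y))"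
    if "is_name P c" for c q
    using assms that by (subst forces_upair_fm; simp)+
  then have "forces P R q (FOr (upair_fm 22 x x) (upair_fm 22 x y)) (e(22 := c)) \<longleftrightarrow>
      forces_mem R q c (opname (e x) (e y))" if "is_name P c" for c q
    unfolding forces_FOr opname_def forces_mem_upname using that by simp
  then show ?thesis
    unfolding forces_eq_iff_ext[OF assms(4) is_name_opname[OF assms(5,6)]] kpair_fm_def
      forces.simps(5) forces_FIff
    using assms by simp
qed

lemma forces_mem_upnameI:
  "forces_eq R p c a \<or> forces_eq R p c b \<Longrightarrow> forces_mem R p c (upname a b)"
  unfolding forces_mem_upname using leq_refl_left forces_eq_mono by blast

lemma forces_mem_upnameE:
  assumes "forces_mem R p c (upname a b)" "leq R q p"
  obtains r where "leq R r q" "forces_eq R r c a \<or> forces_eq R r c b"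
  using assms unfolding forces_mem_upname by blast

lemma forces_eq_upname:
  assumes "is_name P a" "is_name P b" "is_name P c" "is_name P d"
    and "forces_eq R p a c" "forces_eq R p b d"
  shows "forces_eq R p (upname a b) (upname c d)"
proof (rule forces_eq_ext)
  fix q s assume q: "leq R q p"
  have "forces_eq R r s a \<longleftrightarrow> forces_eq R r s c" "forces_eq R r s b \<longleftrightarrow> forces_eq R r s d"
    if "leq R r q" for r
    using forces_eq_mono[OF assms(5) leq_trans[OF that q]] forces_eq_mono[OF assms(6) leq_trans[OF that q]]
    by (blast intro: forces_eq_trans forces_eq_sym)+
  moreover have "leq R r q" if "leq R r q1" "leq R q1 q" for r q1 using leq_trans that .
  ultimately show "forces_mem R q s (upname a b) \<longleftrightarrow> forces_mem R q s (upname c d)"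
    unfolding forces_mem_upname by blast
qed (use assms is_name_upname in blast)+

lemma forces_eq_opname:
  assumes "is_name P a" "is_name P b" "is_name P c" "is_name P d"
    and "forces_eq R p a c" "forces_eq R p b d"
  shows "forces_eq R p (opname a b) (opname c d)"
  unfolding opname_def by (intro forces_eq_upname is_name_upname assms)

text \<open>Each of the four entries equals one of the entries on the other side. Four successive
  strengthenings decide which one, and the two cases are what remains.\<close>

lemma upname_eqD:
  assumes "forces_eq R p (upname a b) (upname c d)" "leq R q p"
  obtains (straight) r where "leq R r q" "forces_eq R r a c" "forces_eq R r b d"
    | (crossed) r where "leq R r q" "forces_eq R r a d" "forces_eq R r b c"
proof -
  note ab = forces_mem_eq2[OF forces_mem_upnameI assms(1)]
  note cd = forces_mem_eq2[OF forces_mem_upnameI forces_eq_sym[OF assms(1)]]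
  have 1: "forces_mem R p a (upname c d)" "forces_mem R p b (upname c d)"
    by (rule ab; simp)+
  have 2: "forces_mem R p c (upname a b)" "forces_mem R p d (upname a b)"
    by (rule cd; simp)+
  obtain r1 where r1: "leq R r1 q" "forces_eq R r1 a c \<or> forces_eq R r1 a d"
    using 1(1) assms(2) by (rule forces_mem_upnameE)
  have "leq R r1 p" using leq_trans[OF r1(1) assms(2)] .
  with 1(2) obtain r2 where r2: "leq R r2 r1" "forces_eq R r2 b c \<or> forces_eq R r2 b d"
    by (rule forces_mem_upnameE)
  have "leq R r2 p" using leq_trans[OF r2(1) \<open>leq R r1 p\<close>] .
  with 2(1) obtain r3 where r3: "leq R r3 r2" "forces_eq R r3 c a \<or> forces_eq R r3 c b"
    by (rule forces_mem_upnameE)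
  have "leq R r3 p" using leq_trans[OF r3(1) \<open>leq R r2 p\<close>] .
  with 2(2) obtain r4 where r4: "leq R r4 r3" "forces_eq R r4 d a \<or> forces_eq R r4 d b"
    by (rule forces_mem_upnameE)
  have 42: "leq R r4 r2" using leq_trans[OF r4(1) r3(1)] .
  have 41: "leq R r4 r1" using leq_trans[OF 42 r2(1)] .
  have 4: "leq R r4 q" using leq_trans[OF 41 r1(1)] .
  have "forces_eq R r4 a c \<or> forces_eq R r4 a d" "forces_eq R r4 b c \<or> forces_eq R r4 b d"
    "forces_eq R r4 c a \<or> forces_eq R r4 c b"
    using r1(2) r2(2) r3(2) forces_eq_mono[OF _ r4(1)] forces_eq_mono[OF _ 41] forces_eq_mono[OF _ 42]
    by blast+
  with r4(2) have "forces_eq R r4 a c \<and> forces_eq R r4 b d \<or> forces_eq R r4 a d \<and> forces_eq R r4 b c"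
    using forces_eq_sym[of r4] forces_eq_trans[of r4] by blast
  with 4 that show ?thesis by blast
qed

lemma upname_doubleton_eqD:
  assumes "forces_eq R p (upname a b) (upname c c)" "leq R q p"
  obtains r where "leq R r q" "forces_eq R r a c" "forces_eq R r b c"
  using assms by (rule upname_eqD) (rule that; assumption)+

lemma opname_eqD:
  assumes "forces_eq R p (opname a b) (opname c d)"
  shows "forces_eq R p a c" "forces_eq R p b d"
proof -
  have dense: "\<exists>r. leq R r q \<and> forces_eq R r a c \<and> forces_eq R r b d" if q: "leq R q p" for q
    using assms[unfolded opname_def] q
  proof (cases rule: upname_eqD)
    case (straight r)
    obtain r1 where r1: "leq R r1 r" "forces_eq R r1 a c"
      using straight(2) leq_refl_left[OF straight(1)] by (rule upname_doubleton_eqD)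
    from straight(3) r1(1) show ?thesis
    proof (cases rule: upname_eqD)
      case (straight r2)
      then show ?thesis
        using forces_eq_mono[OF r1(2)] leq_trans[OF _ leq_trans[OF r1(1) \<open>leq R r q\<close>]] by blast
    next
      case (crossed r2)
      have ac: "forces_eq R r2 a c" using forces_eq_mono[OF r1(2) crossed(1)] .
      have "forces_eq R r2 b d"
        using forces_eq_trans[OF forces_eq_trans[OF crossed(3) forces_eq_sym[OF ac]] crossed(2)] .
      with ac show ?thesis
        using leq_trans[OF crossed(1) leq_trans[OF r1(1) \<open>leq R r q\<close>]] by blast
    qed
  next
    \<comment> \<open>Here the singleton of \<open>a\<close> equals the pair of \<open>c\<close> and
      \<open>d\<close>, and the pair of \<open>a\<close> and \<open>b\<close> equals the singleton
      of \<open>c\<close>, so all four entries coincide below a stronger condition.\<close>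
    case (crossed r)
    obtain r1 where r1: "leq R r1 r" "forces_eq R r1 c a" "forces_eq R r1 d a"
      using forces_eq_sym[OF crossed(2)] leq_refl_left[OF crossed(1)] by (rule upname_doubleton_eqD)
    obtain r2 where r2: "leq R r2 r1" "forces_eq R r2 b c"
      using crossed(3) r1(1) by (rule upname_doubleton_eqD)
    have ca: "forces_eq R r2 c a" and da: "forces_eq R r2 d a"
      using forces_eq_mono[OF r1(2) r2(1)] forces_eq_mono[OF r1(3) r2(1)] .
    have "forces_eq R r2 b d"
      using forces_eq_trans[OF forces_eq_trans[OF r2(2) ca] forces_eq_sym[OF da]] .
    with forces_eq_sym[OF ca] show ?thesis
      using leq_trans[OF r2(1) leq_trans[OF r1(1) crossed(1)]] by blast
  qed
  show "forces_eq R p a c" "forces_eq R p b d"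
    by (rule forces_eq_dense, use dense in blast)+
qed


section \<open>Canonical names\<close>

lemma elts_check: "elts (check P x) = (\<Union>y\<in>elts x. kpair (check P y) ` elts P)"
proof -
  have "(\<Union>y\<in>elts x. {kpair (check P y) p | p. p \<in> elts P}) =
      (\<Union>y\<in>elts x. kpair (check P y) ` elts P)" by blast
  moreover have "small (\<Union>y\<in>elts x. kpair (check P y) ` elts P)"
    by (rule small_UN[OF small_elts small_image[OF small_elts]])
  ultimately show ?thesis by (subst check.simps) (simp add: elts_vset)
qed

lemma is_name_check: "is_name P (check P x)"
proof (induction x rule: elts_induct)
  case (less x)
  then show ?case by (intro is_name.intros) (auto simp: elts_check)
qed

lemma forces_mem_check:
  "forces_mem R p a (check P x) \<longleftrightarrow>
    (\<forall>q. leq R q p \<longrightarrow> (\<exists>r y. leq R r q \<and> y \<in> elts x \<and> forces_eq R r a (check P y)))"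
proof -
  have "(\<exists>s r. leq R q' q \<and> kpair s r \<in> elts (check P x) \<and> leq R q' r \<and> forces_eq R q' a s) \<longleftrightarrow>
    (\<exists>y. leq R q' q \<and> y \<in> elts x \<and> forces_eq R q' a (check P y))" for q q'
    using leq_in[of q' q] leq_refl_left[of q' q] by (auto simp: elts_check)
  then show ?thesis unfolding forces_mem_def by simp
qed

lemma forces_mem_checkI:
  assumes "y \<in> elts x" "p \<in> elts P" shows "forces_mem R p (check P y) (check P x)"
  by (rule forces_mem_elts[of _ p]) (use assms in \<open>auto simp: elts_check\<close>)

lemma forces_mem_checkE:
  assumes "forces_mem R p a (check P x)" "leq R q p"
  obtains r y where "leq R r q" "y \<in> elts x" "forces_eq R r a (check P y)"
  using assms unfolding forces_mem_check by blast

text \<open>Membership induction on \<open>x\<close> alone: for a member of \<open>y\<close>, the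
  hypothesis is used at the matching member of \<open>x\<close> after turning the equality
  around.\<close>

lemma forces_eq_checkD:
  assumes "forces_eq R p (check P x) (check P y)" "p \<in> elts P"
  shows "x = y"
  using assms
proof (induction x arbitrary: y p rule: elts_induct)
  case (less x)
  note pp = leq_refl[OF less.prems(2)]
  show ?case
  proof (rule extensionality, intro set_eqI iffI)
    fix z assume z: "z \<in> elts x"
    have "forces_mem R p (check P z) (check P y)"
      using forces_mem_eq2[OF forces_mem_checkI[OF z less.prems(2)] less.prems(1)] .
    then obtain r z' where "leq R r p" "z' \<in> elts y" "forces_eq R r (check P z) (check P z')"
      using forces_mem_checkE[OF _ pp] by blast
    then show "z \<in> elts y" using less.IH[OF z] leq_in by blast
  next
    fix z assume z: "z \<in> elts y"
    have "forces_mem R p (check P z) (check P x)"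
      using forces_mem_eq2[OF forces_mem_checkI[OF z less.prems(2)] forces_eq_sym[OF less.prems(1)]] .
    then obtain r z' where "leq R r p" "z' \<in> elts x" "forces_eq R r (check P z) (check P z')"
      using forces_mem_checkE[OF _ pp] by blast
    then show "z \<in> elts x" using less.IH forces_eq_sym leq_in by blast
  qed
qed

lemma forces_mem_checkD:
  assumes "forces_mem R p (check P x) (check P y)" "p \<in> elts P"
  shows "x \<in> elts y"
  using forces_mem_checkE[OF assms(1) leq_refl[OF assms(2)]] forces_eq_checkD leq_in by metis

text \<open>The right-hand side is what \<open>forces_FOr\<close> produces from the successor clause
  of \<open>inductive_fm\<close>.\<close>

lemma forces_mem_check_Suc:
  "forces_mem R p c (check P (vnat (Suc n))) \<longleftrightarrow>
    (\<forall>q. leq R q p \<longrightarrow>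
      (\<exists>r. leq R r q \<and> (forces_mem R r c (check P (vnat n)) \<or> forces_eq R r c (check P (vnat n)))))"
    (is "?l \<longleftrightarrow> ?r")
proof
  assume l: ?l
  show ?r
  proof (intro allI impI)
    fix q assume "leq R q p"
    with l obtain r y where r: "leq R r q" "y \<in> elts (vnat (Suc n))" "forces_eq R r c (check P y)"
      by (rule forces_mem_checkE)
    from r(2) consider "y = vnat n" | "y \<in> elts (vnat n)" unfolding elts_vnat_Suc by blast
    then show "\<exists>r. leq R r q \<and>
        (forces_mem R r c (check P (vnat n)) \<or> forces_eq R r c (check P (vnat n)))"
    proof cases
      case 1
      then show ?thesis using r by blast
    next
      case 2
      have "forces_mem R r c (check P (vnat n))"
        using forces_mem_eq1[OF forces_mem_checkI[OF 2] forces_eq_sym[OF r(3)]] leq_in[OF r(1)] by blast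
      then show ?thesis using r(1) by blast
    qed
  qed
next
  assume r: ?r
  show ?l
  proof (rule forces_mem_dense)
    fix q assume "leq R q p"
    with r obtain r where r: "leq R r q"
      "forces_mem R r c (check P (vnat n)) \<or> forces_eq R r c (check P (vnat n))"
      by blast
    have "forces_mem R r c (check P (vnat (Suc n)))"
      using r(2)
    proof
      assume "forces_mem R r c (check P (vnat n))"
      then show ?thesis unfolding forces_mem_check elts_vnat_Suc by blast
    next
      assume "forces_eq R r c (check P (vnat n))"
      moreover have "forces_mem R r (check P (vnat n)) (check P (vnat (Suc n)))"
        by (rule forces_mem_checkI) (use leq_in[OF r(1)] in \<open>simp_all only: elts_vnat_Suc insertI1\<close>)
      ultimately show ?thesis using forces_mem_eq1 forces_eq_sym by blast
    qed
    with r(1) show "\<exists>r. leq R r q \<and> forces_mem R r c (check P (vnat (Suc n)))" by blast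
  qed
qed

section \<open>Zero, successor and omega in the extension\<close>

lemma forces_empty:
  assumes "is_name P (e 23)"
  shows "forces P R p (FAll 24 (FNeg (FMem 24 23))) e \<longleftrightarrow> forces_eq R p (e 23) (check P (vnat 0))"
proof -
  have "\<not> forces_mem R q c (check P (vnat 0))" if "leq R q p" for c q
    using leq_refl_left[OF that] unfolding forces_mem_check elts_vnat_0 by blast
  then show ?thesis
    unfolding forces_eq_iff_ext[OF assms is_name_check] forces.simps(3,5) using assms by auto
qed

lemma forces_succ:
  assumes "is_name P (e 23)" "is_name P (e 25)" "forces_eq R p (e 23) (check P (vnat n))"
  shows "forces P R p (FAll 24 (FIff (FMem 24 25) (FOr (FMem 24 23) (FEq 24 23)))) e \<longleftrightarrow>
    forces_eq R p (e 25) (check P (vnat (Suc n)))"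
proof -
  have "forces_mem R r c (check P (vnat n)) \<longleftrightarrow> forces_mem R r c (e 23)"
    "forces_eq R r c (check P (vnat n)) \<longleftrightarrow> forces_eq R r c (e 23)" if "leq R r p" for r c
    using forces_eq_mono[OF assms(3) that]
    by (blast intro: forces_mem_eq2 forces_eq_trans forces_eq_sym)+
  then have "forces_mem R q c (check P (vnat (Suc n))) \<longleftrightarrow>
      (\<forall>q1. leq R q1 q \<longrightarrow> (\<exists>r. leq R r q1 \<and> (forces_mem R r c (e 23) \<or> forces_eq R r c (e 23))))"
    if "leq R q p" for q c
    unfolding forces_mem_check_Suc using leq_trans[OF leq_trans that] by metis
  then show ?thesis
    unfolding forces_eq_iff_ext[OF assms(2) is_name_check] forces.simps(5) forces_FIff
    unfolding forces_FOr
    by simp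
qed

lemma forces_inductive_vomega:
  assumes "e w = check P vomega" "w \<notin> {23, 24, 25}" "p \<in> elts P"
  shows "forces P R p (inductive_fm w) e"
proof -
  have mem: "forces_mem R q (check P (vnat n)) (check P vomega)" if "q \<in> elts P" for n q
    using that by (intro forces_mem_checkI) (simp_all add: elts_vomega)
  have 1: "forces P R p (FBex 23 w (FAll 24 (FNeg (FMem 24 23)))) e"
    by (rule forces_FBexI[where a = "check P (vnat 0)"])
      (use assms in \<open>simp_all add: is_name_check forces_empty mem del: vnat.simps\<close>)
  have 2: "forces P R p (FBall 23 w (FBex 25 w
      (FAll 24 (FIff (FMem 24 25) (FOr (FMem 24 23) (FEq 24 23)))))) e"
  proof (rule forces_FBallI)
    fix a q assume A: "is_name P a" "leq R q p" "forces_mem R q a ((e(23 := a)) w)"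
    then have "forces_mem R q a (check P vomega)" using assms by simp
    then obtain r y where r: "leq R r q" "y \<in> elts vomega" "forces_eq R r a (check P y)"
      by (rule forces_mem_checkE[OF _ leq_refl_left[OF A(2)]])
    then obtain n where n: "forces_eq R r a (check P (vnat n))" by (auto simp: elts_vomega)
    have "forces P R r (FBex 25 w (FAll 24 (FIff (FMem 24 25) (FOr (FMem 24 23) (FEq 24 23)))))
        (e(23 := a))"
    proof (rule forces_FBexI[OF is_name_check])
      show "forces_mem R r (check P (vnat (Suc n))) ((e(23 := a, 25 := check P (vnat (Suc n)))) w)"
        using assms mem[of r "Suc n"] leq_in[OF r(1)] by (simp del: vnat.simps)
      show "forces P R r (FAll 24 (FIff (FMem 24 25) (FOr (FMem 24 23) (FEq 24 23))))
          (e(23 := a, 25 := check P (vnat (Suc n))))"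
        by (subst forces_succ[where n = n])
          (use A n in \<open>simp_all add: is_name_check del: vnat.simps\<close>)
    qed
    with r(1) show "\<exists>r. leq R r q \<and> forces P R r (FBex 25 w
        (FAll 24 (FIff (FMem 24 25) (FOr (FMem 24 23) (FEq 24 23))))) (e(23 := a))" by blast
  qed
  show ?thesis unfolding inductive_fm_def forces.simps(4) using 1 2 by blast
qed

text \<open>Ordinary induction on \<open>n\<close> is enough, because the members of
  \<open>vomega\<close> are exactly the numerals of natural numbers. This is why no smaller
  inductive set appears in the extension.\<close>

lemma forces_inductiveD:
  assumes "forces P R p (inductive_fm w) e" "w \<notin> {23, 24, 25}"
  shows "forces_mem R p (check P (vnat n)) (e w)"
proof (induction n)
  case 0
  show ?case
  proof (rule forces_mem_dense)
    fix q assume q: "leq R q p"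
    have "forces P R p (FBex 23 w (FAll 24 (FNeg (FMem 24 23)))) e"
      using assms(1) unfolding inductive_fm_def forces.simps(4) by blast
    then obtain r a where r: "leq R r q" "is_name P a" "forces_mem R r a ((e(23 := a)) w)"
      "forces P R r (FAll 24 (FNeg (FMem 24 23))) (e(23 := a))"
      using q unfolding forces_FBex by blast
    then have "forces_eq R r a (check P (vnat 0))" "forces_mem R r a (e w)"
      using assms(2) forces_empty[of "e(23 := a)" r] by simp_all
    then show "\<exists>r. leq R r q \<and> forces_mem R r (check P (vnat 0)) (e w)"
      using r(1) forces_mem_eq1 by blast
  qed
next
  case (Suc n)
  show ?case
  proof (rule forces_mem_dense)
    fix q assume q: "leq R q p"
    have "forces P R p (FBall 23 w (FBex 25 w
        (FAll 24 (FIff (FMem 24 25) (FOr (FMem 24 23) (FEq 24 23)))))) e"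
      using assms(1) unfolding inductive_fm_def forces.simps(4) by blast
    moreover have "forces_mem R q (check P (vnat n)) ((e(23 := check P (vnat n))) w)"
      using assms(2) forces_mem_mono[OF Suc.IH q] by simp
    ultimately have "forces P R q (FBex 25 w
        (FAll 24 (FIff (FMem 24 25) (FOr (FMem 24 23) (FEq 24 23))))) (e(23 := check P (vnat n)))"
      using q is_name_check unfolding forces_FBall by blast
    then obtain r a where r: "leq R r q" "is_name P a"
      "forces_mem R r a ((e(23 := check P (vnat n), 25 := a)) w)"
      "forces P R r (FAll 24 (FIff (FMem 24 25) (FOr (FMem 24 23) (FEq 24 23))))
        (e(23 := check P (vnat n), 25 := a))"
      using leq_refl_left[OF q] unfolding forces_FBex by blast
    then have "forces_eq R r a (check P (vnat (Suc n)))" "forces_mem R r a (e w)"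
      using assms(2) forces_succ[of "e(23 := check P (vnat n), 25 := a)" r n]
      by (simp_all add: is_name_check del: vnat.simps)
    then show "\<exists>r. leq R r q \<and> forces_mem R r (check P (vnat (Suc n))) (e w)"
      using r(1) forces_mem_eq1 by blast
  qed
qed

lemma forces_omega_fm:
  assumes "e w = check P vomega" "w \<notin> {20, 23, 24, 25, 26}" "p \<in> elts P"
  shows "forces P R p (omega_fm w) e"
  unfolding omega_fm_def forces.simps(4,5) forces_FImp
proof (intro conjI allI impI)
  show "forces P R p (inductive_fm w) e"
    using assms by (intro forces_inductive_vomega) auto
  fix I q assume I: "is_name P I" "leq R q p" "forces P R q (inductive_fm 26) (e(26 := I))"
  \<comment> \<open>A name for a member of omega is densely decided to be a particular numeral,
    which any inductive \<open>I\<close> is forced to contain.\<close>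
  have "forces_mem R r a I" if a: "leq R r q" "forces_mem R r a (check P vomega)" for a r
  proof (rule forces_mem_dense)
    fix r1 assume "leq R r1 r"
    with a(2) obtain r2 y where r2: "leq R r2 r1" "y \<in> elts vomega" "forces_eq R r2 a (check P y)"
      by (rule forces_mem_checkE)
    then obtain n where n: "forces_eq R r2 a (check P (vnat n))" by (auto simp: elts_vomega)
    have "leq R r2 q" using leq_trans[OF r2(1) leq_trans[OF \<open>leq R r1 r\<close> a(1)]] .
    then have "forces_mem R r2 (check P (vnat n)) I"
      using forces_mem_mono[OF forces_inductiveD[OF I(3)]] by simp
    then show "\<exists>r. leq R r r1 \<and> forces_mem R r a I"
      using r2(1) n forces_mem_eq1 forces_eq_sym by blast
  qed
  then show "forces P R q (subset_fm w 26) (e(26 := I))"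
    using assms by (simp add: forces_subset_fm)
qed


section \<open>Names for countable sets\<close>

text \<open>The parameter \<open>f\<close> lets one construction serve twice: for the countable set
  itself and for its enumeration, each member under the same condition \<open>fst d\<close>.\<close>

definition ctblname :: "('v \<times> 'v \<Rightarrow> 'v) \<Rightarrow> ('v \<times> 'v) set \<Rightarrow> 'v" where
  "ctblname f D = vset ((\<lambda>d. kpair (f d) (fst d)) ` D)"

lemma elts_ctblname: "countable D \<Longrightarrow> elts (ctblname f D) = (\<lambda>d. kpair (f d) (fst d)) ` D"
  unfolding ctblname_def by (intro elts_vset countable_imp_small countable_image)

lemma is_name_ctblname:
  assumes "countable D" "\<And>d. d \<in> D \<Longrightarrow> fst d \<in> elts P \<and> is_name P (f d)"
  shows "is_name P (ctblname f D)"
  by (rule is_name.intros) (use assms in \<open>auto simp: elts_ctblname\<close>)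

lemma forces_mem_ctblnameI:
  assumes "countable D" "d \<in> D" "leq R p (fst d)"
  shows "forces_mem R p (f d) (ctblname f D)"
  by (rule forces_mem_elts[OF _ assms(3)]) (use assms in \<open>auto simp: elts_ctblname\<close>)

lemma forces_mem_ctblnameE:
  assumes "forces_mem R p a (ctblname f D)" "leq R q p" "countable D"
  obtains r d where "leq R r q" "d \<in> D" "leq R r (fst d)" "forces_eq R r a (f d)"
proof -
  obtain r s t where r: "leq R r q" "kpair s t \<in> elts (ctblname f D)" "leq R r t" "forces_eq R r a s"
    using assms(1,2) by (rule forces_memD)
  then obtain d where "d \<in> D" "s = f d" "t = fst d" using assms(3) by (auto simp: elts_ctblname)
  with r that show ?thesis by blast
qed

text \<open>An element \<open>(r, u)\<close> of \<open>D\<close> is a condition \<open>r\<close> with a name \<open>u\<close>, and \<open>ctblname snd D\<close> names the set of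
  all \<open>u\<close> with \<open>r\<close> generic. Its enumeration in the extension uses the indices of an enumeration of \<open>D\<close> in
  the ground model.\<close>

lemma forces_countable_fm:
  assumes D: "countable D" "\<And>d. d \<in> D \<Longrightarrow> fst d \<in> elts P \<and> is_name P (snd d)"
    and W: "W < 20 \<or> 33 < W" "e W = ctblname snd D" and p: "p \<in> elts P"
  shows "forces P R p (countable_fm W) e"
proof -
  define N :: "'v \<times> 'v \<Rightarrow> 'v" where "N d = check P (vnat (to_nat_on D d))" for d
  \<comment> \<open>The domain of this function in the extension is the set of indices of those
    \<open>d\<close> whose condition is generic; \<open>countable_fm\<close> allows any subset of
    omega.\<close>
  define f where "f = ctblname (\<lambda>d. opname (N d) (snd d)) D"
  have nameN: "is_name P (N d)" for d unfolding N_def by (rule is_name_check)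
  have nameop: "is_name P (opname (N d) (snd d))" if "d \<in> D" for d
    using D(2)[OF that] nameN is_name_opname by blast
  have namef: "is_name P f" unfolding f_def using D nameop by (blast intro: is_name_ctblname)
  have Nmem: "forces_mem R q (N d) (check P vomega)" if "q \<in> elts P" for q d
    unfolding N_def by (rule forces_mem_checkI[OF _ that]) (simp add: elts_vomega)
  have fE: "\<exists>r d. leq R r q \<and> d \<in> D \<and> leq R r (fst d) \<and> forces_eq R r v (opname (N d) (snd d))"
    if "forces_mem R q' v f" "leq R q q'" for q q' v
    using that D(1) unfolding f_def by (rule forces_mem_ctblnameE) blast
  \<comment> \<open>Canonical names of distinct numerals are never forced equal, so an index
    determines its pair in \<open>D\<close>. This makes \<open>f\<close> single-valued.\<close>
  have N_inj: "d = d'" if "forces_eq R q (N d) (N d')" "d \<in> D" "d' \<in> D" "q \<in> elts P" for q d d'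
  proof -
    have "vnat (to_nat_on D d) = (vnat (to_nat_on D d') :: 'v)"
      using forces_eq_checkD that(1,4) unfolding N_def by blast
    then show ?thesis
      using inj_vnat[THEN injD] that(2,3) to_nat_on_inj[OF D(1)] by blast
  qed
  define e2 where "e2 = e(27 := check P vomega, 28 := f)"
  have e2: "e2 27 = check P vomega" "e2 28 = f" "e2 W = ctblname snd D"
    using W by (auto simp: e2_def)
  have Wn: "W \<noteq> 29" "W \<noteq> 30" "W \<noteq> 31" using W by auto
  have c0: "forces P R p (omega_fm 27) e2"
    by (rule forces_omega_fm) (simp_all add: e2 p)
  have c1: "forces P R p (FBall 29 28 (FBex 30 27 (FBex 31 W (kpair_fm 29 30 31)))) e2"
  proof (rule forces_FBallI)
    fix v q assume v: "is_name P v" "leq R q p" "forces_mem R q v ((e2(29 := v)) 28)"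
    then have "forces_mem R q v f" by (simp add: e2)
    then obtain r d where r: "leq R r q" "d \<in> D" "leq R r (fst d)"
      "forces_eq R r v (opname (N d) (snd d))"
      using fE leq_refl_left[OF v(2)] by blast
    have "r \<in> elts P" using leq_in[OF r(1)] by blast
    have "forces P R r (FBex 30 27 (FBex 31 W (kpair_fm 29 30 31))) (e2(29 := v))"
    proof (rule forces_FBexI[OF nameN])
      show "forces_mem R r (N d) ((e2(29 := v, 30 := N d)) 27)"
        using Nmem[OF \<open>r \<in> elts P\<close>] by (simp add: e2)
      show "forces P R r (FBex 31 W (kpair_fm 29 30 31)) (e2(29 := v, 30 := N d))"
      proof (rule forces_FBexI)
        show "is_name P (snd d)" using D(2)[OF r(2)] by blast
        show "forces_mem R r (snd d) ((e2(29 := v, 30 := N d, 31 := snd d)) W)"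
          using forces_mem_ctblnameI[OF D(1) r(2,3)] Wn by (simp add: e2)
        show "forces P R r (kpair_fm 29 30 31) (e2(29 := v, 30 := N d, 31 := snd d))"
          using v(1) nameN D(2)[OF r(2)] r(4) by (subst forces_kpair_fm) simp_all
      qed
    qed
    with r(1) show "\<exists>r. leq R r q \<and>
        forces P R r (FBex 30 27 (FBex 31 W (kpair_fm 29 30 31))) (e2(29 := v))" by blast
  qed
  have c2: "forces P R p (FAll 30 (FAll 31 (FAll 32 (FBall 29 28 (FBall 33 28
      (FImp (FAnd (kpair_fm 29 30 31) (kpair_fm 33 30 32)) (FEq 31 32))))))) e2"
    unfolding forces.simps(5)[of _ _ _ 30] forces.simps(5)[of _ _ _ 31] forces.simps(5)[of _ _ _ 32]
      forces_FBall forces_FImp forces.simps(4)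
  proof (intro allI impI, elim conjE)
    fix a b c v q v' q' q''
    assume names: "is_name P a" "is_name P b" "is_name P c" "is_name P v" "is_name P v'"
      and q: "leq R q p" "leq R q' q" "leq R q'' q'"
      and v: "forces_mem R q v ((e2(30 := a, 31 := b, 32 := c, 29 := v)) 28)"
      and v': "forces_mem R q' v' ((e2(30 := a, 31 := b, 32 := c, 29 := v, 33 := v')) 28)"
      and k: "forces P R q'' (kpair_fm 29 30 31) (e2(30 := a, 31 := b, 32 := c, 29 := v, 33 := v'))"
      and k': "forces P R q'' (kpair_fm 33 30 32) (e2(30 := a, 31 := b, 32 := c, 29 := v, 33 := v'))"
    have vf: "forces_mem R q v f" "forces_mem R q' v' f" using v v' by (simp_all add: e2)
    have kk: "forces_eq R q'' v (opname a b)" "forces_eq R q'' v' (opname a c)"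
      using k k' names by (simp_all add: forces_kpair_fm)
    \<comment> \<open>Strengthening decides which \<open>d\<close> and \<open>d'\<close> the two
      pairs come from; their common first coordinate \<open>a\<close> then forces
      \<open>d = d'\<close>.\<close>
    have "forces_eq R q'' b c"
    proof (rule forces_eq_dense)
      fix r assume r: "leq R r q''"
      have rq': "leq R r q'" using leq_trans[OF r q(3)] .
      obtain r1 d where r1: "leq R r1 r" "d \<in> D" "forces_eq R r1 v (opname (N d) (snd d))"
        using fE[OF vf(1) leq_trans[OF rq' q(2)]] by blast
      obtain r2 d' where r2: "leq R r2 r1" "d' \<in> D" "forces_eq R r2 v' (opname (N d') (snd d'))"
        using fE[OF vf(2) leq_trans[OF r1(1) rq']] by blast
      have r2q: "leq R r2 q''" using leq_trans[OF r2(1) leq_trans[OF r1(1) r]] .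
      note ab = opname_eqD[OF forces_eq_trans[OF forces_eq_sym[OF forces_eq_mono[OF kk(1) r2q]]
            forces_eq_mono[OF r1(3) r2(1)]]]
      note ac = opname_eqD[OF forces_eq_trans[OF forces_eq_sym[OF forces_eq_mono[OF kk(2) r2q]] r2(3)]]
      have "d = d'"
        using N_inj[OF forces_eq_trans[OF forces_eq_sym[OF ab(1)] ac(1)] r1(2) r2(2)] leq_in[OF r2(1)]
        by blast
      then have "forces_eq R r2 b c"
        using forces_eq_trans[OF ab(2)] forces_eq_sym[OF ac(2)] by simp
      with leq_trans[OF r2(1) r1(1)] show "\<exists>r'. leq R r' r \<and> forces_eq R r' b c" by blast
    qed
    then show "forces P R q'' (FEq 31 32) (e2(30 := a, 31 := b, 32 := c, 29 := v, 33 := v'))"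
      by simp
  qed
  have c3: "forces P R p (FBall 31 W (FBex 30 27 (FBex 29 28 (kpair_fm 29 30 31)))) e2"
  proof (rule forces_FBallI)
    fix u q assume u: "is_name P u" "leq R q p" "forces_mem R q u ((e2(31 := u)) W)"
    then have "forces_mem R q u (ctblname snd D)" using Wn by (simp add: e2)
    then obtain r d where r: "leq R r q" "d \<in> D" "leq R r (fst d)" "forces_eq R r u (snd d)"
      using leq_refl_left[OF u(2)] D(1) by (rule forces_mem_ctblnameE)
    have "r \<in> elts P" using leq_in[OF r(1)] by blast
    have "forces_mem R r (opname (N d) (snd d)) f"
      using forces_mem_ctblnameI[OF D(1) r(2,3), of "\<lambda>d. opname (N d) (snd d)"]
      unfolding f_def .
    moreover have "forces_eq R r (opname (N d) (snd d)) (opname (N d) u)"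
      using forces_eq_opname[OF nameN _ nameN u(1) forces_eq_refl forces_eq_sym[OF r(4)]] D(2)[OF r(2)]
      by blast
    ultimately have mem: "forces_mem R r (opname (N d) u) f" by (rule forces_mem_eq1)
    have "forces P R r (FBex 30 27 (FBex 29 28 (kpair_fm 29 30 31))) (e2(31 := u))"
    proof (rule forces_FBexI[OF nameN])
      show "forces_mem R r (N d) ((e2(31 := u, 30 := N d)) 27)"
        using Nmem[OF \<open>r \<in> elts P\<close>] by (simp add: e2)
      show "forces P R r (FBex 29 28 (kpair_fm 29 30 31)) (e2(31 := u, 30 := N d))"
      proof (rule forces_FBexI)
        show name: "is_name P (opname (N d) u)" by (rule is_name_opname[OF nameN u(1)])
        show "forces_mem R r (opname (N d) u) ((e2(31 := u, 30 := N d, 29 := opname (N d) u)) 28)"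
          using mem by (simp add: e2)
        show "forces P R r (kpair_fm 29 30 31) (e2(31 := u, 30 := N d, 29 := opname (N d) u))"
          using name nameN u(1) by (subst forces_kpair_fm) simp_all
      qed
    qed
    with r(1) show "\<exists>r. leq R r q \<and>
        forces P R r (FBex 30 27 (FBex 29 28 (kpair_fm 29 30 31))) (e2(31 := u))" by blast
  qed
  show ?thesis
    unfolding countable_fm_def
  proof (rule forces_FExI[OF is_name_check[of vomega]], rule forces_FExI[OF namef], fold e2_def)
    show "forces P R p (FAnd (omega_fm 27)
       (FAnd (FBall 29 28 (FBex 30 27 (FBex 31 W (kpair_fm 29 30 31))))
       (FAnd (FAll 30 (FAll 31 (FAll 32 (FBall 29 28 (FBall 33 28
                (FImp (FAnd (kpair_fm 29 30 31) (kpair_fm 33 30 32)) (FEq 31 32)))))))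
             (FBall 31 W (FBex 30 27 (FBex 29 28 (kpair_fm 29 30 31))))))) e2"
      unfolding forces.simps(4) using c0 c1 c2 c3 by (intro conjI)
  qed
qed


section \<open>Covers\<close>

text \<open>The open set \<open>u\<close> may be new, but it is a union of sets from the ground
  model basis. A condition can therefore decide one basic set around \<open>x\<close>, and that set
  is available to a covering argument in the ground model.\<close>

lemma forces_open_cover_refine:
  assumes e: "e 0 = check P X" "e 1 = check P \<tau>" "e 39 = U"
    and op: "forces P R q (FBall 40 39 (open_fm 40 1)) e"
    and cov: "forces P R q (covers_fm 39 0) e"
    and q': "leq R q' q" and x: "x \<in> elts X"
  obtains r u B where "leq R r q'" "is_name P u" "B \<in> elts \<tau>" "x \<in> elts B" "forces_mem R r u U"
    "\<And>y. y \<in> elts B \<Longrightarrow> forces_mem R r (check P y) u"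
proof -
  have inP: "q' \<in> elts P" using leq_in[OF q'] by blast
  have "forces_mem R q' (check P x) ((e(37 := check P x)) 0)"
    using forces_mem_checkI[OF x inP] by (simp add: e)
  then have "forces P R q' (FBex 38 39 (FMem 37 38)) (e(37 := check P x))"
    using cov[unfolded covers_fm_def forces_FBall] is_name_check q' by blast
  then obtain r u where r: "leq R r q'" "is_name P u"
    "forces_mem R r u ((e(37 := check P x, 38 := u)) 39)"
    "forces P R r (FMem 37 38) (e(37 := check P x, 38 := u))"
    using leq_refl[OF inP] unfolding forces_FBex by blast
  have u: "forces_mem R r u U" "forces_mem R r (check P x) u"
    using r(3,4) by (simp_all add: e)
  have rq: "leq R r q" using leq_trans[OF r(1) q'] .
  have "forces_mem R r u ((e(40 := u)) 39)" using u(1) by (simp add: e)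
  then have "forces P R r (open_fm 40 1) (e(40 := u))"
    using op r(2) rq unfolding forces_FBall by blast
  then obtain r1 s where r1: "leq R r1 r"
    and sub: "forces P R r1 (subset_fm 34 1) (e(40 := u, 34 := s))"
    and un: "forces P R r1 (FAll 35 (FIff (FMem 35 40) (FBex 36 34 (FMem 35 36)))) (e(40 := u, 34 := s))"
    using leq_refl_left[OF r(1)] unfolding open_fm_def forces_FEx forces.simps(4) by blast
  \<comment> \<open>Used in both directions: from \<open>x\<close> in \<open>u\<close> to a basic
    set containing \<open>x\<close>, and from the points of that basic set back into
    \<open>u\<close>.\<close>
  have mem_u: "forces_mem R t c u \<longleftrightarrow>
      forces P R t (FBex 36 34 (FMem 35 36)) (e(40 := u, 34 := s, 35 := c))"
    if "leq R t r1" "is_name P c" for t c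
    using un that unfolding forces.simps(5) forces_FIff by simp
  have "forces P R r1 (FBex 36 34 (FMem 35 36)) (e(40 := u, 34 := s, 35 := check P x))"
    using mem_u[OF leq_refl_left[OF r1] is_name_check] forces_mem_mono[OF u(2) r1] by blast
  then obtain r2 b where r2: "leq R r2 r1" "is_name P b"
    "forces_mem R r2 b ((e(40 := u, 34 := s, 35 := check P x, 36 := b)) 34)"
    "forces P R r2 (FMem 35 36) (e(40 := u, 34 := s, 35 := check P x, 36 := b))"
    using leq_refl_left[OF r1] unfolding forces_FBex by blast
  have b: "forces_mem R r2 b s" "forces_mem R r2 (check P x) b" using r2(3,4) by simp_all
  have "forces_mem R r2 b (check P \<tau>)"
    using sub b(1) r2(1,2) by (simp add: forces_subset_fm e(2)[unfolded One_nat_def])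
  then obtain r3 B where r3: "leq R r3 r2" "B \<in> elts \<tau>" "forces_eq R r3 b (check P B)"
    using leq_refl_left[OF r2(1)] by (rule forces_mem_checkE)
  have r31: "leq R r3 r1" using leq_trans[OF r3(1) r2(1)] .
  have r3P: "r3 \<in> elts P" using leq_in[OF r31] by blast
  have "x \<in> elts B"
    using forces_mem_checkD[OF forces_mem_eq2[OF forces_mem_mono[OF b(2) r3(1)] r3(3)] r3P] .
  moreover have "forces_mem R r3 (check P y) u" if "y \<in> elts B" for y
  proof -
    have "forces_mem R r3 (check P y) b"
      using forces_mem_eq2[OF forces_mem_checkI[OF that r3P] forces_eq_sym[OF r3(3)]] .
    then have "forces P R r3 (FBex 36 34 (FMem 35 36)) (e(40 := u, 34 := s, 35 := check P y))"
      using forces_mem_mono[OF b(1) r3(1)] by (intro forces_FBexI[OF r2(2)]) simp_all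
    then show ?thesis using mem_u[OF r31 is_name_check] by blast
  qed
  ultimately show thesis
    using that leq_trans[OF r31 leq_trans[OF r1 r(1)]] r(2) r3(2)
      forces_mem_mono[OF u(1) leq_trans[OF r31 r1]] by blast
qed

text \<open>One witness is chosen for each set of a countable subcover, not for each point, and the
  same witness serves all points of its set.\<close>

lemma forces_countable_subcover:
  assumes e: "e 0 = check P X" "e 1 = check P \<tau>" "e 39 = U"
    and op: "forces P R q (FBall 40 39 (open_fm 40 1)) e"
    and cov: "forces P R q (covers_fm 39 0) e"
    and t: "leq R t q"
    and T: "codes_topology X \<tau> T" "Lindelof_space T"
  shows "\<exists>A. countable A \<and> (\<forall>(r, u)\<in>A. leq R r t \<and> is_name P u \<and> forces_mem R r u U) \<and>
    (\<forall>x\<in>elts X. \<exists>(r, u)\<in>A. forces_mem R r (check P x) u)"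
proof -
  define good where "good B d \<longleftrightarrow> leq R (fst d) t \<and> is_name P (snd d) \<and>
    forces_mem R (fst d) (snd d) U \<and> (\<forall>y\<in>B. forces_mem R (fst d) (check P y) (snd d))" for B d
  \<comment> \<open>A family in the ground model, to which the Lindelof property of \<open>T\<close>
    applies; refining the forced cover below \<open>t\<close> at each point shows that it
    covers.\<close>
  define \<U> where "\<U> = {B. openin T B \<and> (\<exists>d. good B d)}"
  have top: "topspace T = elts X" "elts ` elts \<tau> = {B. openin T B}"
    using T(1) by (simp_all add: codes_topology_def)
  have "topspace T \<subseteq> \<Union>\<U>"
  proof
    fix x assume "x \<in> topspace T"
    then have x: "x \<in> elts X" by (simp add: top)
    obtain r u B where 1: "leq R r t" "is_name P u" "B \<in> elts \<tau>" "x \<in> elts B" "forces_mem R r u U"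
      "\<And>y. y \<in> elts B \<Longrightarrow> forces_mem R r (check P y) u"
      by (rule forces_open_cover_refine[OF e op cov t x]) (rule that)
    have "elts B \<in> {B. openin T B}" unfolding top(2)[symmetric] using 1(3) by (rule imageI)
    moreover have "good (elts B) (r, u)" unfolding good_def using 1 by simp
    ultimately have "elts B \<in> \<U>" unfolding \<U>_def by blast
    then show "x \<in> \<Union>\<U>" using 1(4) by (rule UnionI)
  qed
  moreover have "\<forall>B\<in>\<U>. openin T B" by (simp add: \<U>_def)
  ultimately obtain \<V> where V: "countable \<V>" "\<V> \<subseteq> \<U>" "topspace T \<subseteq> \<Union>\<V>"
    using T(2)[unfolded Lindelof_space_alt, THEN spec[of _ \<U>]] by (elim impE exE conjE) simp_all
  have "\<forall>B\<in>\<V>. \<exists>d. good B d"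
    using V(2) unfolding \<U>_def by blast
  then obtain g where g: "\<forall>B\<in>\<V>. good B (g B)" by (rule bchoice[THEN exE])
  show ?thesis
  proof (intro exI[of _ "g ` \<V>"] conjI ballI)
    show "countable (g ` \<V>)" using V(1) by simp
    show "case d of (r, u) \<Rightarrow> leq R r t \<and> is_name P u \<and> forces_mem R r u U"
      if d: "d \<in> g ` \<V>" for d
    proof -
      obtain B where "B \<in> \<V>" "d = g B" using d by blast
      then have "good B d" using g by simp
      then show ?thesis unfolding good_def by (simp add: case_prod_beta)
    qed
    show "\<exists>(r, u)\<in>g ` \<V>. forces_mem R r (check P x) u" if x: "x \<in> elts X" for x
    proof -
      have "x \<in> \<Union>\<V>" using V(3) x unfolding top(1) by (rule subsetD)
      then obtain B where B: "B \<in> \<V>" "x \<in> B" by (rule UnionE)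
      then have "good B (g B)" using g by simp
      then have "forces_mem R (fst (g B)) (check P x) (snd (g B))"
        unfolding good_def using B(2) by simp
      then show ?thesis using B(1) by (intro bexI[of _ "g B"]) (simp_all add: case_prod_beta)
    qed
  qed
qed

text \<open>The forcing side of the argument: it leaves only the density claim \<open>cov\<close>
  about ground model points and conditions. The subcover is named by \<open>D\<close>; its members
  lie in \<open>U\<close> because the condition attached to each forces this.\<close>

lemma forces_subcoverI:
  assumes e: "e 0 = check P X" "e 39 = U"
    and D: "countable D"
      "\<And>d. d \<in> D \<Longrightarrow> fst d \<in> elts P \<and> is_name P (snd d) \<and> forces_mem R (fst d) (snd d) U"
    and cov: "\<And>x s. x \<in> elts X \<Longrightarrow> leq R s r \<Longrightarrow>
      \<exists>s' d. leq R s' s \<and> d \<in> D \<and> leq R s' (fst d) \<and> forces_mem R (fst d) (check P x) (snd d)"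
    and r: "r \<in> elts P"
  shows "forces P R r (FEx 41 (FAnd (subset_fm 41 39) (FAnd (countable_fm 41) (covers_fm 41 0)))) e"
proof (rule forces_FExI)
  define W where "W = ctblname snd D"
  show "is_name P (ctblname snd D)" using D by (intro is_name_ctblname) auto
  have "forces_mem R q a U" if q: "forces_mem R q a W" for q a
  proof (rule forces_mem_dense)
    fix q1 assume "leq R q1 q"
    with q obtain r d where r: "leq R r q1" "d \<in> D" "leq R r (fst d)" "forces_eq R r a (snd d)"
      unfolding W_def using D(1) by (rule forces_mem_ctblnameE)
    have "forces_mem R r (snd d) U" using forces_mem_mono[OF _ r(3)] D(2)[OF r(2)] by blast
    then have "forces_mem R r a U" using forces_mem_eq1 forces_eq_sym[OF r(4)] by blast
    with r(1) show "\<exists>r. leq R r q1 \<and> forces_mem R r a U" by blast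
  qed
  then have 1: "forces P R r (subset_fm 41 39) (e(41 := W))"
    by (simp add: forces_subset_fm e)
  have 2: "forces P R r (countable_fm 41) (e(41 := W))"
    using D r by (intro forces_countable_fm) (auto simp: W_def)
  have 3: "forces P R r (covers_fm 41 0) (e(41 := W))"
    unfolding covers_fm_def
  proof (rule forces_FBallI)
    fix a q assume a: "is_name P a" "leq R q r" "forces_mem R q a ((e(41 := W, 37 := a)) 0)"
    then have "forces_mem R q a (check P X)" by (simp add: e)
    then obtain s x where s: "leq R s q" "x \<in> elts X" "forces_eq R s a (check P x)"
      using leq_refl_left[OF a(2)] by (rule forces_mem_checkE)
    obtain s' d where s': "leq R s' s" "d \<in> D" "leq R s' (fst d)"
      "forces_mem R (fst d) (check P x) (snd d)"
      using cov[OF s(2) leq_trans[OF s(1) a(2)]] by blast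
    have "forces_mem R s' a (snd d)"
      using forces_mem_eq1[OF forces_mem_mono[OF s'(4,3)] forces_eq_sym[OF forces_eq_mono[OF s(3) s'(1)]]] .
    moreover have "forces_mem R s' (snd d) W"
      unfolding W_def using forces_mem_ctblnameI[OF D(1) s'(2,3)] .
    moreover have "is_name P (snd d)" using D(2)[OF s'(2)] by blast
    ultimately have "forces P R s' (FBex 38 41 (FMem 37 38)) (e(41 := W, 37 := a))"
      by (intro forces_FBexI[of "snd d"]) simp_all
    with leq_trans[OF s'(1) s(1)]
    show "\<exists>s'. leq R s' q \<and> forces P R s' (FBex 38 41 (FMem 37 38)) (e(41 := W, 37 := a))"
      by blast
  qed
  show "forces P R r (FAnd (subset_fm 41 39) (FAnd (countable_fm 41) (covers_fm 41 0)))
      (e(41 := ctblname snd D))"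
    unfolding forces.simps(4) using 1 2 3 unfolding W_def by blast
qed

text \<open>Stationarity and strong properness enter here. The conclusion speaks of some
  \<open>r\<close> below \<open>q\<close>, since strong properness only provides strongly generic
  extensions of \<open>q\<close>.\<close>

lemma forces_subcover:
  assumes e: "e 0 = check P X" "e 1 = check P \<tau>" "e 39 = U" and q: "q \<in> elts P"
    and op: "forces P R q (FBall 40 39 (open_fm 40 1)) e"
    and cov: "forces P R q (covers_fm 39 0) e"
    and T: "codes_topology X \<tau> T" "Lindelof_space T"
    and K: "elts P \<subseteq> K" and S: "stationary K S" "\<And>M. M \<in> S \<Longrightarrow> strongly_proper_for P R M"
  shows "\<exists>r. leq R r q \<and>
      forces P R r (FEx 41 (FAnd (subset_fm 41 39) (FAnd (countable_fm 41) (covers_fm 41 0)))) e"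
proof -
  define Q where "Q t A \<longleftrightarrow> countable A \<and>
    (\<forall>(r, u)\<in>A. leq R r t \<and> is_name P u \<and> forces_mem R r u U) \<and>
    (\<forall>x\<in>elts X. \<exists>(r, u)\<in>A. forces_mem R r (check P x) u)" for t and A :: "('v \<times> 'v) set"
  define A where "A t = (SOME A. Q t A)" for t
  have QA: "Q t (A t)" if "leq R t q" for t
    unfolding A_def using forces_countable_subcover[OF e op cov that T, folded Q_def] by (rule someI_ex)
  have A: "countable (A t)"
    "\<And>r u. (r, u) \<in> A t \<Longrightarrow> leq R r t \<and> is_name P u \<and> forces_mem R r u U"
    "\<And>x. x \<in> elts X \<Longrightarrow> \<exists>(r, u)\<in>A t. forces_mem R r (check P x) u" if "leq R t q" for t
    using QA[OF that] unfolding Q_def by fast+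
  define c where "c t = (SOME t'. leq R t' t \<and> leq R t' q)" for t
  \<comment> \<open>The constant part puts \<open>q\<close> into any nonempty closed
    \<open>M\<close>. The case distinctions leave out those \<open>t\<close> at which
    \<open>c\<close> or \<open>A\<close> is an arbitrary choice.\<close>
  define F where "F t = {q} \<union> (if compatible R t q then {c t} else {}) \<union>
    (if leq R t q then fst ` A t else {})" for t
  have c: "leq R (c t) t \<and> leq R (c t) q" if "compatible R t q" for t
    using that unfolding compatible_def c_def by (rule someI_ex)
  have FP: "F t \<subseteq> elts P" for t
  proof -
    have "c t \<in> elts P" if "compatible R t q" using c[OF that] leq_in by blast
    moreover have "fst ` A t \<subseteq> elts P" if "leq R t q"
      using A(2)[OF that] leq_in by (auto; blast)
    ultimately show ?thesis unfolding F_def using q by simp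
  qed
  have Fc: "countable (F t)" for t
    unfolding F_def using A(1)[of t] by simp
  have "club K {M \<in> ctbl_subsets K. \<forall>x\<in>M. F x \<subseteq> M}"
    by (rule club_closed) (simp add: Fc subset_trans[OF FP K])
  then have "S \<inter> {M \<in> ctbl_subsets K. \<forall>x\<in>M. F x \<subseteq> M} \<noteq> {}"
    using S(1) unfolding stationary_def by simp
  then obtain M where "M \<in> S" "M \<in> ctbl_subsets K" and MF: "\<forall>x\<in>M. F x \<subseteq> M" by auto
  have sp: "strongly_proper_for P R M" by (rule S(2)) fact
  have "infinite M" "countable M"
    using \<open>M \<in> ctbl_subsets K\<close> by (simp_all add: ctbl_subsets_def ordIso_natLeq_iff)
  then obtain z where "z \<in> M" by (metis ex_in_conv finite.emptyI)
  moreover have "q \<in> F z" by (simp add: F_def)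
  ultimately have "q \<in> M" using MF by blast
  then obtain p where p: "leq R p q" "strongly_generic P R M p"
    using sp q unfolding strongly_proper_for_def by blast
  define D where "D = (\<Union>t\<in>{t \<in> M. leq R t q}. A t)"
  have "forces P R p (FEx 41 (FAnd (subset_fm 41 39) (FAnd (countable_fm 41) (covers_fm 41 0)))) e"
  proof (rule forces_subcoverI[OF e(1,3), of D])
    show "countable D" unfolding D_def using \<open>countable M\<close> A(1) by (intro countable_UN) simp_all
    show "fst d \<in> elts P \<and> is_name P (snd d) \<and> forces_mem R (fst d) (snd d) U" if d: "d \<in> D" for d
    proof -
      obtain t where "leq R t q" "(fst d, snd d) \<in> A t" using d unfolding D_def by auto
      then show ?thesis using A(2)[of t "fst d" "snd d"] leq_in[of "fst d" t] by blast
    qed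
    show "p \<in> elts P" using leq_in[OF p(1)] by blast
    fix x s assume x: "x \<in> elts X" and s: "leq R s p"
    obtain s0 where s0: "s0 \<in> M" "s0 \<in> elts P" "\<And>t. t \<in> M \<Longrightarrow> leq R t s0 \<Longrightarrow> compatible R t s"
      using p(2) s unfolding strongly_generic_def residue_def by blast
    \<comment> \<open>The residue property at \<open>s0\<close> itself gives compatibility with
      \<open>s\<close>, hence with \<open>q\<close>, which lies above \<open>s\<close>.\<close>
    obtain r where "leq R r s0" "leq R r s"
      using s0(3)[OF s0(1) leq_refl[OF s0(2)]] unfolding compatible_def by blast
    then have comp: "compatible R s0 q"
      unfolding compatible_def using leq_trans[OF _ leq_trans[OF s p(1)]] by blast
    define t where "t = c s0"
    have t: "leq R t s0" "leq R t q" using c[OF comp] by (simp_all add: t_def)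
    have "t \<in> F s0" using comp by (simp add: F_def t_def)
    then have tM: "t \<in> M" using MF s0(1) by blast
    obtain r u where ru: "(r, u) \<in> A t" "forces_mem R r (check P x) u"
      using A(3)[OF t(2) x] by auto
    have "r \<in> F t" using ru(1) t(2) by (force simp: F_def)
    then have "r \<in> M" using MF tM by blast
    \<comment> \<open>\<open>s\<close> need not belong to \<open>M\<close>; only the residue makes
      it compatible with \<open>r\<close>, and this needs \<open>r\<close> both in \<open>M\<close>
      and below \<open>s0\<close>.\<close>
    moreover have "leq R r s0" using A(2)[OF t(2) ru(1)] leq_trans[OF _ t(1)] by blast
    ultimately obtain s' where s': "leq R s' r" "leq R s' s"
      using s0(3) unfolding compatible_def by blast
    have "(r, u) \<in> D" unfolding D_def using ru(1) tM t(2) by blast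
    with s' ru(2) show "\<exists>s' d. leq R s' s \<and> d \<in> D \<and> leq R s' (fst d) \<and>
        forces_mem R (fst d) (check P x) (snd d)" by (intro exI[of _ s'] exI[of _ "(r, u)"]) simp
  qed
  with p(1) show ?thesis by blast
qed

end


section \<open>Preservation\<close>

theorem theorem4p6:
  fixes X \<tau> P R :: "'v::zfc_universe" and T :: "'v topology" and \<theta> :: "'v rel"
  assumes "Card_order \<theta>" and "regularCard \<theta>" and "\<exists>k. elts k = Field \<theta>"
    and "large_enough \<theta> X \<tau> P R"
    and "codes_topology X \<tau> T" and "Lindelof_space T" and "kpair X \<tau> \<in> H \<theta>"
    and "is_poset P R" and "kpair P R \<in> H \<theta>"
    and "stationary (H \<theta>)
           {M \<in> ctbl_subsets (H \<theta>). elementary_submodel M (H \<theta>) \<and>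
              kpair P R \<in> M \<and> strongly_proper_for P R M}"
  shows "forces_Lindelof P R X \<tau>"
proof -
  interpret poset_forcing P R by unfold_locales (rule assms(8))
  have PH: "elts P \<subseteq> H \<theta>"
    using assms(4) by (intro elts_subset_H) (simp add: large_enough_def)
  have main: "\<exists>r. leq R r q \<and>
      forces P R r (FEx 41 (FAnd (subset_fm 41 39) (FAnd (countable_fm 41) (covers_fm 41 0)))) e"
    if e: "e 0 = check P X" "e 1 = check P \<tau>" "e 39 = U" and q: "q \<in> elts P"
      and op: "forces P R q (FBall 40 39 (open_fm 40 1)) e"
      and cov: "forces P R q (covers_fm 39 0) e" for e U q
    using e q op cov assms(5,6) PH assms(10) by (rule forces_subcover) simp
  have "forces P R p (Lindelof_fm 0 1) e"
    if p: "p \<in> elts P" and e: "e 0 = check P X" "e 1 = check P \<tau>" for p e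
    unfolding Lindelof_fm_def forces.simps(5) forces_FImp
  proof (intro allI impI)
    fix U q assume U: "is_name P U" "leq R q p"
      and cover: "forces P R q (FAnd (FBall 40 39 (open_fm 40 1)) (covers_fm 39 0)) (e(39 := U))"
    show "forces P R q (FEx 41 (FAnd (subset_fm 41 39) (FAnd (countable_fm 41) (covers_fm 41 0))))
        (e(39 := U))"
    \<comment> \<open>\<open>main\<close> finds only a stronger condition, but it applies at every
      \<open>q1\<close> below \<open>q\<close>, so \<open>q\<close> itself forces the subcover to
      exist.\<close>
    proof (rule forces_dense)
      show "q \<in> elts P" using leq_in[OF U(2)] by blast
      fix q1 assume q1: "leq R q1 q"
      have "forces P R q1 (FBall 40 39 (open_fm 40 1)) (e(39 := U))"
        "forces P R q1 (covers_fm 39 0) (e(39 := U))"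
        using forces_mono[OF cover q1] unfolding forces.simps(4) by blast+
      then show "\<exists>r. leq R r q1 \<and> forces P R r (FEx 41 (FAnd (subset_fm 41 39)
          (FAnd (countable_fm 41) (covers_fm 41 0)))) (e(39 := U))"
        using main[of "e(39 := U)" U q1] e leq_in[OF q1] by simp
    qed
  qed
  then show ?thesis unfolding forces_Lindelof_def by blast
qed

end
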